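(* Let $X$ be a separable Banach space and $(S,\Sigma,\nu)$ a $\sigma$-finite measure space. Suppose that $\mathfrak{U}\subseteq\mathcal{L}(X)$ is a closed standard algebra and that $\mathfrak{A}\subseteq L_0^{wo}(\nu;\mathcal{L}(X))$ is a $\mathfrak{U}$-admissible subalgebra. If $\delta:\mathfrak{A}\to\mathfrak{A}$ is an $L_\infty(\nu)$-linear derivation, then there exists $w\in L_0^{wo}(\nu;\mathcal{L}(X))$ such that $\delta(f)=wf-fw$ for all $f\in\mathfrak{A}$.
   Context: Banach spaces are complex; measure spaces are assumed complete. $L_0(\nu)$ (resp. $L_\infty(\nu)$) is the algebra of $\nu$-a.e. equivalence classes of $\nu$-measurable (resp. essentially bounded $\nu$-measurable) complex functions. $\mathcal{L}(X)$ is the algebra of bounded linear operators on $X$ (identity $\mathbf 1$) and $\mathcal{F}(X)$ the subalgebra of finite rank operators. $\mathcal{I}(\mathcal{F}(X))=\{p\in\mathcal{F}(X):p^2=p\}$ and $p^\perp=\mathbf 1-p$. For $X$ separable, $f:S\to\mathcal{L}(X)$ is weak operator $\nu$-measurable if $s\mapsto\langle f(s)x,x^*\rangle$ is $\nu$-measurable for all $x\in X$, $x^*\in X^*$. For a closed subspace $\mathfrak{B}\subseteq\mathcal{L}(X)$, $L_0^{wo}(\nu;\mathfrak{B})$ is the space of $\nu$-a.e. equivalence classes of weak operator $\nu$-measurable functions $S\to\mathfrak{B}$, and $L_\infty^{wo}(\nu;\mathfrak{B})$ the subspace of essentially bounded ones, with norm $\|f\|_\infty=\operatorname{ess\,sup}_s\|f(s)\|$.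 With pointwise multiplication $L_0^{wo}(\nu;\mathcal{L}(X))$ is a unital algebra; it is an $L_0(\nu)$-module via $(af)(s)=a(s)f(s)$. $\mathbf 1\otimes T$ denotes the constant function $s\mapsto T$, and $\chi_A$ is the indicator function of $A$. A subalgebra $\mathfrak{U}$ of $\mathcal{L}(X)$ is standard if $\mathcal{F}(X)\subseteq\mathfrak{U}$; closed means norm closed. For a closed standard algebra $\mathfrak{U}$, a subalgebra $\mathfrak{A}$ of $L_0^{wo}(\nu;\mathcal{L}(X))$ is $\mathfrak{U}$-admissible if: (i) $\mathfrak{A}\subseteq L_0^{wo}(\nu;\mathfrak{U})$ and $gf\in\mathfrak{A}$ whenever $g\in L_\infty(\nu)$, $f\in\mathfrak{A}$; (ii) if $f\in L_\infty^{wo}(\nu;\mathcal{L}(X))$ and for every $\varepsilon>0$ there is $p\in\mathcal{I}(\mathcal{F}(X))$ with $\|f(\mathbf 1\otimes p^\perp)\|_\infty\le\varepsilon$, then $\chi_Af\in\mathfrak{A}$ for all $\nu$-measurable $A\subseteq S$ with $\nu(A)<\infty$; (iii) for every $f\in L_0^{wo}(\nu;\mathfrak{U})$ there is a $\nu$-measurable partition $\{A_n\}_{n=1}^\infty$ of $S$ with $\chi_{A_n}f\in\mathfrak{A}$ for all $n$. A derivation on an algebra $A$ is a linear map $\delta:A\to A$ with $\delta(xy)=\delta(x)y+x\delta(y)$. It is $L_\infty(\nu)$-linear if $\delta(af)=a\delta(f)$ for all $a\in L_\infty(\nu)$, $f\in\mathfrak{A}$. *)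

theory Defs
  imports "HOL-Probability.Probability"
begin

section \<open>Complex Banach spaces\<close>

text \<open>
  The distribution has only real normed spaces. A complex Banach space is a real one with a
  compatible complex scalar multiplication; \<open>1 *\<^sub>C x = x\<close> is the case \<open>r = 1\<close> of
  \<open>scaleC_of_real\<close>.
\<close>

class complex_banach = banach +
  fixes scaleC :: "complex \<Rightarrow> 'a \<Rightarrow> 'a"  (infixr \<open>*\<^sub>C\<close> 75)
  assumes scaleC_add_right: "a *\<^sub>C (x + y) = a *\<^sub>C x + a *\<^sub>C y"
    and scaleC_add_left: "(a + b) *\<^sub>C x = a *\<^sub>C x + b *\<^sub>C x"
    and scaleC_scaleC: "a *\<^sub>C b *\<^sub>C x = (a * b) *\<^sub>C x"
    and scaleC_of_real: "complex_of_real r *\<^sub>C x = r *\<^sub>R x"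
    and norm_scaleC: "norm (a *\<^sub>C x) = cmod a * norm x"

lemma vector_space_scaleC: "vector_space (scaleC :: complex \<Rightarrow> 'a \<Rightarrow> 'a::complex_banach)"
proof
  show "1 *\<^sub>C x = x" for x :: 'a
    using scaleC_of_real[of 1 x] by simp
qed (simp_all add: scaleC_add_right scaleC_add_left scaleC_scaleC)

interpretation complex_vector:
  vector_space "scaleC :: complex \<Rightarrow> 'a \<Rightarrow> 'a::complex_banach"
  by (rule vector_space_scaleC)

instantiation complex :: complex_banach
begin

definition scaleC_complex :: "complex \<Rightarrow> complex \<Rightarrow> complex"
  where "scaleC_complex a z = a * z"

instance
  by standard (simp_all add: scaleC_complex_def algebra_simps norm_mult scaleR_conv_of_real)

end

lemma bounded_linear_scaleC: "bounded_linear (\<lambda>x::'a::complex_banach. a *\<^sub>C x)"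
proof (rule bounded_linear_intro[where K = "cmod a"])
  show "a *\<^sub>C (r *\<^sub>R x) = r *\<^sub>R (a *\<^sub>C x)" for r and x :: 'a
    by (simp add: scaleC_of_real[symmetric] scaleC_scaleC mult.commute)
qed (simp_all add: scaleC_add_right norm_scaleC mult.commute)

lemma bounded_linear_scaleC_blinfun:
  "bounded_linear (\<lambda>x. a *\<^sub>C blinfun_apply (T :: 'a::real_normed_vector \<Rightarrow>\<^sub>L 'b::complex_banach) x)"
  by (rule bounded_linear_compose[OF bounded_linear_scaleC blinfun.bounded_linear_right])

instantiation blinfun :: (real_normed_vector, complex_banach) complex_banach
begin

definition scaleC_blinfun :: "complex \<Rightarrow> 'a \<Rightarrow>\<^sub>L 'b \<Rightarrow> 'a \<Rightarrow>\<^sub>L 'b"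
  where "scaleC_blinfun a T = Blinfun (\<lambda>x. a *\<^sub>C T x)"

lemma blinfun_apply_scaleC:
  "blinfun_apply (a *\<^sub>C (T :: 'a \<Rightarrow>\<^sub>L 'b)) x = a *\<^sub>C blinfun_apply T x"
  by (simp add: scaleC_blinfun_def bounded_linear_Blinfun_apply bounded_linear_scaleC_blinfun)

instance
proof
  fix a b :: complex and r :: real and S T :: "'a \<Rightarrow>\<^sub>L 'b"
  show "a *\<^sub>C (S + T) = a *\<^sub>C S + a *\<^sub>C T"
    by (rule blinfun_eqI) (simp add: blinfun_apply_scaleC blinfun.add_left scaleC_add_right)
  show "(a + b) *\<^sub>C T = a *\<^sub>C T + b *\<^sub>C T"
    by (rule blinfun_eqI) (simp add: blinfun_apply_scaleC blinfun.add_left scaleC_add_left)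
  show "a *\<^sub>C b *\<^sub>C T = (a * b) *\<^sub>C T"
    by (rule blinfun_eqI) (simp add: blinfun_apply_scaleC scaleC_scaleC)
  show "complex_of_real r *\<^sub>C T = r *\<^sub>R T"
    by (rule blinfun_eqI) (simp add: blinfun_apply_scaleC blinfun.scaleR_left scaleC_of_real)
  have le: "norm (c *\<^sub>C U) \<le> cmod c * norm U" for c and U :: "'a \<Rightarrow>\<^sub>L 'b"
  proof (rule norm_blinfun_bound)
    show "norm (blinfun_apply (c *\<^sub>C U) x) \<le> cmod c * norm U * norm x" for x
      using mult_left_mono[OF norm_blinfun[of U x], of "cmod c"]
      by (simp add: blinfun_apply_scaleC norm_scaleC mult.assoc)
  qed simp
  show "norm (a *\<^sub>C T) = cmod a * norm T"
  proof (cases "a = 0")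
    case True
    then show ?thesis
      using le[of 0 T] by simp
  next
    case False
    have "inverse a *\<^sub>C a *\<^sub>C T = T"
      using False complex_vector.scale_one
      by (intro blinfun_eqI) (simp add: blinfun_apply_scaleC)
    then have "norm T \<le> norm (a *\<^sub>C T) / cmod a"
      using le[of "inverse a" "a *\<^sub>C T"] by (simp add: norm_inverse divide_inverse mult.commute)
    then show ?thesis
      using le[of a T] False by (simp add: pos_le_divide_eq mult.commute)
  qed
qed

end


section \<open>Operators\<close>

text \<open>
  Elements of \<^typ>\<open>'a \<Rightarrow>\<^sub>L 'b\<close> are only real-linear, so \<open>\<L>(X)\<close> is \<open>clinear_ops :: ('x \<Rightarrow>\<^sub>L 'x) set\<close>
  and the dual \<open>X\<^sup>*\<close> is \<open>clinear_ops :: ('x \<Rightarrow>\<^sub>L complex) set\<close>. The norm, and hence the notion of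
  a closed set, is the operator norm.
\<close>

definition clinear_ops :: "('a::complex_banach \<Rightarrow>\<^sub>L 'b::complex_banach) set"
  where "clinear_ops = {T. \<forall>c x. blinfun_apply T (c *\<^sub>C x) = c *\<^sub>C blinfun_apply T x}"

definition finite_rank_ops :: "('x::complex_banach \<Rightarrow>\<^sub>L 'x) set"
  where "finite_rank_ops =
    {T \<in> clinear_ops. \<exists>B. finite B \<and> range (blinfun_apply T) \<subseteq> complex_vector.span B}"

definition finite_rank_idempotents :: "('x::complex_banach \<Rightarrow>\<^sub>L 'x) set"
  where "finite_rank_idempotents = {p \<in> finite_rank_ops. p o\<^sub>L p = p}"

definition operator_subalgebra :: "('x::complex_banach \<Rightarrow>\<^sub>L 'x) set \<Rightarrow> bool"
  where "operator_subalgebra U \<longleftrightarrow>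
    U \<subseteq> clinear_ops \<and> complex_vector.subspace U \<and> (\<forall>S\<in>U. \<forall>T\<in>U. S o\<^sub>L T \<in> U)"

definition closed_standard_algebra :: "('x::complex_banach \<Rightarrow>\<^sub>L 'x) set \<Rightarrow> bool"
  where "closed_standard_algebra U \<longleftrightarrow>
    operator_subalgebra U \<and> finite_rank_ops \<subseteq> U \<and> closed U"


section \<open>Weak operator measurable functions modulo null sets\<close>

text \<open>
  Functions on the measure space are total functions on the underlying type whose values outside
  \<open>space M\<close> are irrelevant: they are unconstrained, and functions agreeing almost everywhere
  on \<open>space M\<close> are identified.
\<close>

definition wo_measurable ::
    "'s measure \<Rightarrow> ('x::complex_banach \<Rightarrow>\<^sub>L 'x) set \<Rightarrow> ('s \<Rightarrow> 'x \<Rightarrow>\<^sub>L 'x) set"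
  where "wo_measurable M B =
    {f \<in> space M \<rightarrow> B.
      \<forall>x. \<forall>\<phi> \<in> (clinear_ops :: ('x \<Rightarrow>\<^sub>L complex) set). (\<lambda>s. blinfun_apply \<phi> (blinfun_apply (f s) x)) \<in> borel_measurable M}"

definition ae_rel :: "'s measure \<Rightarrow> (('s \<Rightarrow> 'x::complex_banach \<Rightarrow>\<^sub>L 'x) \<times> ('s \<Rightarrow> 'x \<Rightarrow>\<^sub>L 'x)) set"
  where "ae_rel M = {(f, g). f \<in> wo_measurable M clinear_ops \<and> g \<in> wo_measurable M clinear_ops \<and>
    (AE s in M. f s = g s)}"

lemma equiv_ae_rel: "equiv (wo_measurable M clinear_ops) (ae_rel M)"
proof (rule equivI)
  show "trans (ae_rel M :: (('a \<Rightarrow> 'b \<Rightarrow>\<^sub>L 'b) \<times> ('a \<Rightarrow> 'b \<Rightarrow>\<^sub>L 'b)) set)"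
  proof (rule transI)
    fix f g h :: "'a \<Rightarrow> 'b \<Rightarrow>\<^sub>L 'b"
    assume fg: "(f, g) \<in> ae_rel M" and gh: "(g, h) \<in> ae_rel M"
    then have "AE s in M. f s = g s" "AE s in M. g s = h s"
      by (simp_all add: ae_rel_def)
    then have "AE s in M. f s = h s"
      by eventually_elim simp
    with fg gh show "(f, h) \<in> ae_rel M"
      by (simp add: ae_rel_def)
  qed
qed (auto simp: ae_rel_def refl_on_def sym_def eq_commute)

definition wo_class :: "'s measure \<Rightarrow> ('s \<Rightarrow> 'x::complex_banach \<Rightarrow>\<^sub>L 'x) \<Rightarrow> ('s \<Rightarrow> 'x \<Rightarrow>\<^sub>L 'x) set"
  where "wo_class M f = ae_rel M `` {f}"

text \<open>
  For every \<open>B\<close> the classes are taken in the whole space of \<open>\<L>(X)\<close>-valued functions, so that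
  \<open>L0_wo M B\<close> is literally a subset of \<open>L0_wo M clinear_ops\<close>: it consists of the classes having
  a representative with values in \<open>B\<close>.
\<close>

definition L0_wo ::
    "'s measure \<Rightarrow> ('x::complex_banach \<Rightarrow>\<^sub>L 'x) set \<Rightarrow> ('s \<Rightarrow> 'x \<Rightarrow>\<^sub>L 'x) set set"
  where "L0_wo M B = wo_measurable M B // ae_rel M"

text \<open>
  The operations on classes are lifted from representatives as in the theory of equivalence
  relations; for separable \<open>X\<close> the results, and likewise the essential supremum norm
  below, do not depend on the representatives. Scalar functions are given by
  representatives. Multiplication by \<open>c \<in> \<complex>\<close> is \<open>wo_scale M (\<lambda>_. c)\<close>, and multiplication
  by \<open>\<chi>\<^sub>A\<close> is \<open>wo_scale M (indicator A)\<close>.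
\<close>

definition wo_lift2 ::
    "(('x \<Rightarrow>\<^sub>L 'x) \<Rightarrow> ('x \<Rightarrow>\<^sub>L 'x) \<Rightarrow> ('x \<Rightarrow>\<^sub>L 'x)) \<Rightarrow> 's measure \<Rightarrow>
      ('s \<Rightarrow> 'x::complex_banach \<Rightarrow>\<^sub>L 'x) set \<Rightarrow> ('s \<Rightarrow> 'x \<Rightarrow>\<^sub>L 'x) set \<Rightarrow> ('s \<Rightarrow> 'x \<Rightarrow>\<^sub>L 'x) set"
  where "wo_lift2 h M F G = (\<Union>f\<in>F. \<Union>g\<in>G. wo_class M (\<lambda>s. h (f s) (g s)))"

definition "wo_add = wo_lift2 (+)"

definition "wo_diff = wo_lift2 (-)"

definition "wo_mult = wo_lift2 (o\<^sub>L)"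

definition wo_scale ::
    "'s measure \<Rightarrow> ('s \<Rightarrow> complex) \<Rightarrow> ('s \<Rightarrow> 'x::complex_banach \<Rightarrow>\<^sub>L 'x) set \<Rightarrow> ('s \<Rightarrow> 'x \<Rightarrow>\<^sub>L 'x) set"
  where "wo_scale M a F = (\<Union>f\<in>F. wo_class M (\<lambda>s. a s *\<^sub>C f s))"

definition wo_const :: "'s measure \<Rightarrow> ('x::complex_banach \<Rightarrow>\<^sub>L 'x) \<Rightarrow> ('s \<Rightarrow> 'x \<Rightarrow>\<^sub>L 'x) set"
  where "wo_const M T = wo_class M (\<lambda>_. T)"

definition wo_norm :: "'s measure \<Rightarrow> ('s \<Rightarrow> 'x::complex_banach \<Rightarrow>\<^sub>L 'x) set \<Rightarrow> ennreal"
  where "wo_norm M F = the_elem ((\<lambda>f. esssup M (\<lambda>s. ennreal (norm (f s)))) ` F)"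

definition Linf_wo ::
    "'s measure \<Rightarrow> ('x::complex_banach \<Rightarrow>\<^sub>L 'x) set \<Rightarrow> ('s \<Rightarrow> 'x \<Rightarrow>\<^sub>L 'x) set set"
  where "Linf_wo M B = {F \<in> L0_wo M B. wo_norm M F < \<infinity>}"

definition Linf :: "'s measure \<Rightarrow> ('s \<Rightarrow> complex) set"
  where "Linf M = {a \<in> borel_measurable M. esssup M (\<lambda>s. ennreal (cmod (a s))) < \<infinity>}"


section \<open>Admissible algebras and derivations\<close>

definition wo_subalgebra :: "'s measure \<Rightarrow> ('s \<Rightarrow> 'x::complex_banach \<Rightarrow>\<^sub>L 'x) set set \<Rightarrow> bool"
  where "wo_subalgebra M A \<longleftrightarrow>
    A \<subseteq> L0_wo M clinear_ops \<and>
    wo_const M 0 \<in> A \<and>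
    (\<forall>F\<in>A. \<forall>G\<in>A. wo_add M F G \<in> A) \<and>
    (\<forall>c. \<forall>F\<in>A. wo_scale M (\<lambda>_. c) F \<in> A) \<and>
    (\<forall>F\<in>A. \<forall>G\<in>A. wo_mult M F G \<in> A)"

definition admissible ::
    "'s measure \<Rightarrow> ('x::complex_banach \<Rightarrow>\<^sub>L 'x) set \<Rightarrow> ('s \<Rightarrow> 'x \<Rightarrow>\<^sub>L 'x) set set \<Rightarrow> bool"
  where "admissible M U A \<longleftrightarrow>
    wo_subalgebra M A \<and>
    A \<subseteq> L0_wo M U \<and>
    (\<forall>g\<in>Linf M. \<forall>F\<in>A. wo_scale M g F \<in> A) \<and>
    (\<forall>F\<in>Linf_wo M clinear_ops.
      (\<forall>\<epsilon>::real. \<epsilon> > 0 \<longrightarrow> (\<exists>p\<in>finite_rank_idempotents.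
        wo_norm M (wo_mult M F (wo_const M (id_blinfun - p))) \<le> ennreal \<epsilon>)) \<longrightarrow>
      (\<forall>E\<in>sets M. emeasure M E < \<infinity> \<longrightarrow> wo_scale M (indicator E) F \<in> A)) \<and>
    (\<forall>F\<in>L0_wo M U. \<exists>E :: nat \<Rightarrow> 's set.
      range E \<subseteq> sets M \<and> disjoint_family E \<and> (\<Union>n. E n) = space M \<and>
      (\<forall>n. wo_scale M (indicator (E n)) F \<in> A))"

definition wo_derivation ::
    "'s measure \<Rightarrow> ('s \<Rightarrow> 'x::complex_banach \<Rightarrow>\<^sub>L 'x) set set \<Rightarrow>
      (('s \<Rightarrow> 'x \<Rightarrow>\<^sub>L 'x) set \<Rightarrow> ('s \<Rightarrow> 'x \<Rightarrow>\<^sub>L 'x) set) \<Rightarrow> bool"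
  where "wo_derivation M A \<delta> \<longleftrightarrow>
    \<delta> \<in> A \<rightarrow> A \<and>
    (\<forall>F\<in>A. \<forall>G\<in>A. \<delta> (wo_add M F G) = wo_add M (\<delta> F) (\<delta> G)) \<and>
    (\<forall>c. \<forall>F\<in>A. \<delta> (wo_scale M (\<lambda>_. c) F) = wo_scale M (\<lambda>_. c) (\<delta> F)) \<and>
    (\<forall>F\<in>A. \<forall>G\<in>A. \<delta> (wo_mult M F G) = wo_add M (wo_mult M (\<delta> F) G) (wo_mult M F (\<delta> G)))"

definition Linf_linear_on ::
    "'s measure \<Rightarrow> ('s \<Rightarrow> 'x::complex_banach \<Rightarrow>\<^sub>L 'x) set set \<Rightarrow>
      (('s \<Rightarrow> 'x \<Rightarrow>\<^sub>L 'x) set \<Rightarrow> ('s \<Rightarrow> 'x \<Rightarrow>\<^sub>L 'x) set) \<Rightarrow> bool"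
  where "Linf_linear_on M A \<delta> \<longleftrightarrow>
    (\<forall>a\<in>Linf M. \<forall>F\<in>A. \<delta> (wo_scale M a F) = wo_scale M a (\<delta> F))"

end

theory Submission
  imports Defs
begin

text \<open>
  Fix a vector \<open>x0\<close> and a functional \<open>\<phi>0\<close> with \<open>\<phi>0 x0 = 1\<close>, and write \<open>x \<otimes> \<psi>\<close> for the rank one operator
  \<open>z \<mapsto> \<psi>(z) x\<close>. A derivation \<open>\<delta>\<close> of an algebra of operators that contains the rank one operators can
  only be implemented by \<open>w x = \<delta>(x \<otimes> \<phi>0) x0\<close>, up to a scalar: the product rule for
  \<open>T (x \<otimes> \<phi>0) = T x \<otimes> \<phi>0\<close>, applied to \<open>x0\<close>, reads \<open>w T x = \<delta>(T) x + T w x\<close>. For functions on a set \<open>E\<close> of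
  finite measure, \<open>\<chi>\<^sub>E (x \<otimes> \<phi>0)\<close> belongs to the algebra, and the same formula gives for each \<open>x\<close> a measurable
  function, called \<open>candidate x\<close> below, that is defined up to a null set depending on \<open>x\<close>. Only
  countably many \<open>x\<close> can be handled at the same point \<open>s\<close>, so the operator \<open>w(s)\<close> has to be built from its
  values on a dense sequence, and the work lies in its boundedness and linearity.

  Boundedness (\<open>candidate_bounded\<close>). The closed graph theorem does not apply to a map that is
  known on a countable set only. Its place is taken by a gliding hump inside the algebra. If \<open>X\<close>
  has infinite dimension, it has a biorthogonal sequence \<open>(u\<^sub>n, \<phi>\<^sub>n)\<close>. Suppose that small vectors
  \<open>y\<^sub>n(s)\<close>, taken from a fixed countable set, have very large candidate values. Then \<open>f = \<Sum>\<^sub>n y\<^sub>n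
  \<otimes> \<phi>\<^sub>n\<close> converges in norm, uniformly in \<open>s\<close>. Composing it with \<open>1 - p\<^sub>n\<close>, where \<open>p\<^sub>n\<close> is the
  projection onto the span of the first \<open>n\<close> vectors \<open>u\<^sub>i\<close>, leaves a tail of the series, and so the
  compactness condition of admissibility puts \<open>\<chi>\<^sub>E f\<close> into the algebra. As \<open>f u\<^sub>n = y\<^sub>n\<close>, the
  product rule bounds the candidate at \<open>y\<^sub>n\<close> by \<open>\<parallel>\<delta>(f)(s)\<parallel> \<parallel>u\<^sub>n\<parallel> + \<parallel>f(s)\<parallel> \<parallel>candidate u\<^sub>n s\<parallel>\<close>; as
  the first factors do not depend on \<open>n\<close>, the \<open>y\<^sub>n\<close> were chosen too large. In finite dimension
  boundedness follows from linearity.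

  Linearity and the commutator identity. Sandwiching \<open>f\<close> between \<open>x0 \<otimes> \<psi>\<close> and \<open>x \<otimes> \<phi>0\<close> gives the
  function \<open>\<psi>(f x) (x0 \<otimes> \<phi>0)\<close>, a scalar multiple of a fixed element, and \<open>\<delta>\<close> is linear over measurable scalars.
  This expresses the functional values of the candidate through bounded linear maps that are defined on
  all of \<open>X\<close> (\<open>consistent_candidate\<close>, \<open>sandwich\<close>). For \<open>\<psi>\<close> in a countable norming set these identities
  hold simultaneously almost everywhere; they force linearity of the extension \<open>w(s)\<close> and, being
  continuous, extend from the dense sequence to vectors such as \<open>f(s) x\<close>, where they yield
  \<open>\<delta>(f) = w f - f w\<close> (\<open>inner_on\<close>). Countably many such \<open>w\<close> are glued together over a cover of the
  measure space by sets of finite measure.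
\<close>

section \<open>Norming functionals\<close>

definition sublinear :: "('a::real_vector \<Rightarrow> real) \<Rightarrow> bool"
  where "sublinear q \<longleftrightarrow> (\<forall>x y. q (x + y) \<le> q x + q y) \<and> (\<forall>t>0. \<forall>x. q (t *\<^sub>R x) = t * q x)"

lemma sublinear_zero: "sublinear q \<Longrightarrow> q 0 = 0"
proof -
  assume "sublinear q"
  then have "q (2 *\<^sub>R 0) = 2 * q 0" unfolding sublinear_def by (meson zero_less_numeral)
  then show ?thesis by simp
qed

lemma sublinear_minus:
  assumes "sublinear q"
  shows "- q (- x) \<le> q x"
proof -
  have "q (x + (- x)) \<le> q x + q (- x)"
    using assms unfolding sublinear_def by blast
  then show ?thesis using sublinear_zero[OF assms] by simp
qed

text \<open>
  The largest sublinear function below \<open>q\<close> whose value at \<open>- y\<close> is at most \<open>- q y\<close>. It serves twice: it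
  shows that a minimal \<open>q\<close> is additive, and for the norm it forces a functional below it to attain the
  norm at \<open>y\<close>.
\<close>

definition sublinear_shift :: "('a::real_vector \<Rightarrow> real) \<Rightarrow> 'a \<Rightarrow> 'a \<Rightarrow> real"
  where "sublinear_shift q y x = (INF t\<in>{0..}. q (x + t *\<^sub>R y) - t * q y)"

lemma sublinear_shift_le:
  assumes "sublinear q" "0 \<le> t"
  shows "sublinear_shift q y x \<le> q (x + t *\<^sub>R y) - t * q y"
proof -
  have "- q (- x) \<le> q (x + r *\<^sub>R y) - r * q y" if "0 \<le> r" for r
  proof -
    have "q ((x + r *\<^sub>R y) + (- x)) \<le> q (x + r *\<^sub>R y) + q (- x)"
      using assms(1) unfolding sublinear_def by blast
    moreover have "q (r *\<^sub>R y) = r * q y"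
      using assms(1) sublinear_zero[OF assms(1)] that unfolding sublinear_def
      by (cases "r = 0") auto
    ultimately show ?thesis by simp
  qed
  then show ?thesis
    unfolding sublinear_shift_def using assms(2)
    by (intro cINF_lower bdd_belowI2[where m = "- q (- x)"]) auto
qed

lemma sublinear_sublinear_shift:
  assumes q: "sublinear q"
  shows "sublinear (sublinear_shift q y)"
  unfolding sublinear_def
proof (intro conjI allI impI)
  fix x z
  show "sublinear_shift q y (x + z) \<le> sublinear_shift q y x + sublinear_shift q y z"
  proof -
    have *: "sublinear_shift q y (x + z) - (q (z + r *\<^sub>R y) - r * q y) \<le> q (x + t *\<^sub>R y) - t * q y"
      if "0 \<le> r" "0 \<le> t" for r t
    proof -
      have "q ((x + t *\<^sub>R y) + (z + r *\<^sub>R y)) \<le> q (x + t *\<^sub>R y) + q (z + r *\<^sub>R y)"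
        using q unfolding sublinear_def by blast
      moreover have "(x + t *\<^sub>R y) + (z + r *\<^sub>R y) = (x + z) + (t + r) *\<^sub>R y"
        by (simp add: algebra_simps)
      ultimately show ?thesis
        using sublinear_shift_le[OF q, of "t + r" y "x + z"] that by (simp add: algebra_simps)
    qed
    then have "sublinear_shift q y (x + z) - (q (z + r *\<^sub>R y) - r * q y) \<le> sublinear_shift q y x"
      if "0 \<le> r" for r
      unfolding sublinear_shift_def[of q y x] using that by (intro cINF_greatest) auto
    then have "sublinear_shift q y (x + z) - sublinear_shift q y x \<le> q (z + r *\<^sub>R y) - r * q y"
      if "0 \<le> r" for r using that by (simp add: algebra_simps)
    then have "sublinear_shift q y (x + z) - sublinear_shift q y x \<le> sublinear_shift q y z"
      unfolding sublinear_shift_def[of q y z] by (intro cINF_greatest) auto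
    then show ?thesis by simp
  qed
next
  have le: "sublinear_shift q y (c *\<^sub>R x) \<le> c * sublinear_shift q y x" if "c > 0" for c x
  proof -
    have "sublinear_shift q y (c *\<^sub>R x) / c \<le> q (x + t *\<^sub>R y) - t * q y" if "0 \<le> t" for t
    proof -
      have "sublinear_shift q y (c *\<^sub>R x) \<le> q (c *\<^sub>R x + (c * t) *\<^sub>R y) - (c * t) * q y"
        using that \<open>c > 0\<close> by (intro sublinear_shift_le[OF q]) auto
      also have "c *\<^sub>R x + (c * t) *\<^sub>R y = c *\<^sub>R (x + t *\<^sub>R y)"
        by (simp add: algebra_simps)
      also have "q (c *\<^sub>R (x + t *\<^sub>R y)) = c * q (x + t *\<^sub>R y)"
        using q \<open>c > 0\<close> unfolding sublinear_def by blast
      finally show ?thesis using \<open>c > 0\<close> by (simp add: field_simps)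
    qed
    then have "sublinear_shift q y (c *\<^sub>R x) / c \<le> sublinear_shift q y x"
      unfolding sublinear_shift_def[of q y x] by (intro cINF_greatest) auto
    then show ?thesis using \<open>c > 0\<close> by (simp add: field_simps)
  qed
  fix t :: real and x
  assume t: "t > 0"
  show "sublinear_shift q y (t *\<^sub>R x) = t * sublinear_shift q y x"
  proof (rule antisym[OF le[OF t]])
    have "sublinear_shift q y ((1/t) *\<^sub>R (t *\<^sub>R x)) \<le> (1/t) * sublinear_shift q y (t *\<^sub>R x)"
      using t by (intro le) auto
    then show "t * sublinear_shift q y x \<le> sublinear_shift q y (t *\<^sub>R x)"
      using t by (simp add: field_simps)
  qed
qed

text \<open>
  Zorn's lemma on total sublinear functions, ordered pointwise, so that no partially defined
  functionals occur. The infimum of a chain is finite because \<open>q x \<ge> - q (- x) \<ge> - p (- x)\<close>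
  for every sublinear \<open>q\<close> below \<open>p\<close>.
\<close>

lemma exists_minimal_sublinear:
  assumes p: "sublinear p"
  shows "\<exists>m. sublinear m \<and> (\<forall>x. m x \<le> p x) \<and> (\<forall>q. sublinear q \<longrightarrow> (\<forall>x. q x \<le> m x) \<longrightarrow> q = m)"
proof -
  let ?S = "{q. sublinear q \<and> (\<forall>x. q x \<le> p x)}"
  let ?P = "\<lambda>a b :: 'a \<Rightarrow> real. \<forall>x. b x \<le> a x"
  have "\<exists>m\<in>?S. \<forall>a\<in>?S. ?P m a \<longrightarrow> a = m"
  proof (rule predicate_Zorn)
    show "partial_order_on ?S (relation_of ?P ?S)"
      by (rule partial_order_on_relation_ofI) (auto intro: order_trans antisym simp: fun_eq_iff)
    fix C
    assume "C \<in> Chains (relation_of ?P ?S)"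
    then have CS: "C \<subseteq> ?S" and ch: "\<And>a b. a \<in> C \<Longrightarrow> b \<in> C \<Longrightarrow> ?P a b \<or> ?P b a"
      unfolding Chains_def relation_of_def by blast+
    show "\<exists>u\<in>?S. \<forall>a\<in>C. ?P a u"
    proof (cases "C = {}")
      case True
      with p show ?thesis by auto
    next
      case False
      define u where "u x = (INF q\<in>C. q x)" for x
      have bdd: "bdd_below ((\<lambda>q. q x) ` C)" for x
      proof (rule bdd_belowI2)
        fix q assume "q \<in> C"
        then have "sublinear q" "q (- x) \<le> p (- x)" using CS by auto
        then show "- p (- x) \<le> q x" using sublinear_minus[of q x] by simp
      qed
      have lower: "u x \<le> q x" if "q \<in> C" for q x
        unfolding u_def by (rule cINF_lower[OF bdd that])
      have greatest: "c \<le> u x" if "\<And>q. q \<in> C \<Longrightarrow> c \<le> q x" for c x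
        unfolding u_def using False that by (intro cINF_greatest)
      have "sublinear u"
        unfolding sublinear_def
      proof (intro conjI allI impI)
        fix x y
        have "u (x + y) \<le> q x + r y" if qr: "q \<in> C" "r \<in> C" for q r
        proof -
          obtain s where s: "s \<in> C" "s x \<le> q x" "s y \<le> r y"
            using ch[OF qr] qr by blast
          have "u (x + y) \<le> s (x + y)" using lower s by blast
          also have "\<dots> \<le> s x + s y" using CS s unfolding sublinear_def by blast
          finally show ?thesis using s by simp
        qed
        then have "u (x + y) - r y \<le> u x" if "r \<in> C" for r
          using that by (intro greatest) (simp add: diff_le_eq)
        then have "u (x + y) - u x \<le> u y"
          by (intro greatest) (simp add: algebra_simps)
        then show "u (x + y) \<le> u x + u y" by simp
      next
        fix t :: real and x
        assume t: "t > 0"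
        have hom: "q (t *\<^sub>R x) = t * q x" if "q \<in> C" for q
          using CS that t unfolding sublinear_def by blast
        show "u (t *\<^sub>R x) = t * u x"
        proof (rule antisym)
          have "u (t *\<^sub>R x) / t \<le> u x"
            using lower[of _ "t *\<^sub>R x"] hom t by (intro greatest) (simp add: field_simps)
          then show "u (t *\<^sub>R x) \<le> t * u x" using t by (simp add: field_simps)
          show "t * u x \<le> u (t *\<^sub>R x)"
          proof (rule greatest)
            fix q assume "q \<in> C"
            with lower[of q x] t have "t * u x \<le> t * q x" by simp
            then show "t * u x \<le> q (t *\<^sub>R x)" using hom[OF \<open>q \<in> C\<close>] by simp
          qed
        qed
      qed
      moreover have "u x \<le> p x" for x
      proof -
        obtain q where "q \<in> C" using False by blast
        then have "u x \<le> q x" "q x \<le> p x" using lower CS by blast+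
        then show ?thesis by (rule order_trans)
      qed
      ultimately show ?thesis using lower by blast
    qed
  qed
  then obtain m where m: "m \<in> ?S" and min: "\<And>a. a \<in> ?S \<Longrightarrow> ?P m a \<Longrightarrow> a = m"
    by blast
  have "q = m" if "sublinear q" "\<forall>x. q x \<le> m x" for q
  proof (rule min)
    have "q x \<le> p x" for x
      using order_trans[of "q x" "m x" "p x"] that m by blast
    with that show "q \<in> ?S" by blast
  qed (rule that(2))
  then show ?thesis using m by blast
qed

text \<open>
  By minimality \<open>m\<close> equals its shift along \<open>y\<close>, and the term \<open>t = 1\<close> of the infimum that defines the shift is
  the missing inequality.
\<close>

lemma minimal_sublinear_additive:
  assumes m: "sublinear m" and min: "\<And>q. sublinear q \<Longrightarrow> (\<And>x. q x \<le> m x) \<Longrightarrow> q = m"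
  shows "m (x + y) = m x + m y"
proof (rule antisym)
  show "m (x + y) \<le> m x + m y"
    using m unfolding sublinear_def by blast
  have "sublinear_shift m y = m"
    using sublinear_shift_le[OF m, of 0 y] by (intro min sublinear_sublinear_shift m) simp
  then show "m x + m y \<le> m (x + y)"
    using sublinear_shift_le[OF m, of 1 y x] by simp
qed

lemma real_norming_functional:
  fixes x :: "'a::real_normed_vector"
  obtains f :: "'a \<Rightarrow> real" where "linear f" "\<And>y. f y \<le> norm y" "f x = norm x"
proof -
  have norm: "sublinear (norm :: 'a \<Rightarrow> real)"
    by (simp add: sublinear_def norm_triangle_ineq)
  obtain m where m: "sublinear m" and le: "\<And>y. m y \<le> sublinear_shift norm x y"
    and min: "\<And>q. sublinear q \<Longrightarrow> (\<And>y. q y \<le> m y) \<Longrightarrow> q = m"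
    using exists_minimal_sublinear[OF sublinear_sublinear_shift[OF norm, of x]] by blast
  have add: "m (y + z) = m y + m z" for y z
    using minimal_sublinear_additive[OF m min] by blast
  have neg: "m (- y) = - m y" for y
    using add[of y "- y"] sublinear_zero[OF m] by simp
  have "linear m"
  proof (rule linearI[OF add])
    fix r :: real and y
    have pos: "m (t *\<^sub>R y) = t * m y" if "t > 0" for t
      using m that unfolding sublinear_def by blast
    show "m (r *\<^sub>R y) = r *\<^sub>R m y"
      using pos[of r] pos[of "- r"] neg[of "r *\<^sub>R y"] sublinear_zero[OF m]
      by (cases r "0 :: real" rule: linorder_cases) auto
  qed
  moreover have le_norm: "m y \<le> norm y" for y
    using le[of y] sublinear_shift_le[OF norm, of 0 x y] by simp
  moreover have "m x = norm x"
  proof (rule antisym[OF le_norm])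
    show "norm x \<le> m x"
      using le[of "- x"] sublinear_shift_le[OF norm, of 1 x "- x"] neg[of x] by simp
  qed
  ultimately show ?thesis by (rule that)
qed

lemma scaleC_ii: "\<i> *\<^sub>C \<i> *\<^sub>C x = - (x :: 'a::complex_banach)"
  using scaleC_of_real[of "-1" x] by (simp add: scaleC_scaleC)

lemma scaleR_scaleC: "r *\<^sub>R x = complex_of_real r *\<^sub>C (x :: 'a::complex_banach)"
  by (simp add: scaleC_of_real)

text \<open>
  The complex functional with real part \<open>f\<close> is \<open>f(y) - \<i> f(\<i> y)\<close>; rotating \<open>g y\<close> onto the positive axis
  transfers the bound from \<open>f\<close>.
\<close>

lemma norming_functional:
  fixes x :: "'a::complex_banach"
  obtains \<phi> :: "'a \<Rightarrow>\<^sub>L complex" where "\<phi> \<in> clinear_ops" "norm \<phi> \<le> 1" "\<phi> x = of_real (norm x)"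
proof -
  obtain f :: "'a \<Rightarrow> real" where lin: "linear f" and le: "\<And>y. f y \<le> norm y" and fx: "f x = norm x"
    using real_norming_functional[of x] by blast
  define g where "g y = Complex (f y) (- f (\<i> *\<^sub>C y))" for y
  have g_add: "g (y + z) = g y + g z" for y z
    by (simp add: g_def complex_eq_iff scaleC_add_right linear_add[OF lin])
  have g_real: "g (complex_of_real r *\<^sub>C y) = of_real r * g y" for r y
  proof -
    have "\<i> *\<^sub>C complex_of_real r *\<^sub>C y = r *\<^sub>R \<i> *\<^sub>C y"
      by (simp add: scaleR_scaleC scaleC_scaleC mult.commute)
    then show ?thesis
      by (simp add: g_def complex_eq_iff scaleC_of_real linear_scale[OF lin])
  qed
  have g_ii: "g (\<i> *\<^sub>C y) = \<i> * g y" for y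
    by (simp add: g_def complex_eq_iff scaleC_ii linear_neg[OF lin])
  have g_scale: "g (c *\<^sub>C y) = c * g y" for c y
  proof -
    have "c *\<^sub>C y = complex_of_real (Re c) *\<^sub>C y + complex_of_real (Im c) *\<^sub>C \<i> *\<^sub>C y"
      unfolding scaleC_scaleC scaleC_add_left[symmetric]
      by (rule arg_cong[where f = "\<lambda>c. c *\<^sub>C y"]) (simp add: complex_eq_iff)
    then have "g (c *\<^sub>C y) = g (complex_of_real (Re c) *\<^sub>C y + complex_of_real (Im c) *\<^sub>C \<i> *\<^sub>C y)"
      by (rule arg_cong)
    also have "\<dots> = (of_real (Re c) + of_real (Im c) * \<i>) * g y"
      unfolding g_add g_real g_ii by (simp add: algebra_simps)
    also have "of_real (Re c) + of_real (Im c) * \<i> = c"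
      by (simp add: complex_eq_iff)
    finally show ?thesis .
  qed
  have bound: "cmod (g y) \<le> norm y" for y
  proof (cases "g y = 0")
    case False
    define c where "c = cnj (g y) / of_real (cmod (g y))"
    have "c * g y = (g y * cnj (g y)) / of_real (cmod (g y))"
      by (simp add: c_def)
    also have "\<dots> = of_real (cmod (g y))"
      using False by (simp add: complex_norm_square[symmetric] power2_eq_square)
    finally have "c * g y = of_real (cmod (g y))" .
    moreover have "cmod c = 1"
      using False by (simp add: c_def norm_divide)
    moreover have "Re (g (c *\<^sub>C y)) \<le> norm (c *\<^sub>C y)"
      using le[of "c *\<^sub>C y"] by (simp add: g_def)
    ultimately show ?thesis
      by (simp add: g_scale norm_scaleC)
  qed simp
  have bl: "bounded_linear g"
    by (rule bounded_linear_intro[where K = 1])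
      (use bound g_scale[of "complex_of_real _"] in \<open>auto simp: g_add scaleR_scaleC scaleR_conv_of_real scaleC_complex_def\<close>)
  have ap: "blinfun_apply (Blinfun g) = g"
    by (rule bounded_linear_Blinfun_apply[OF bl])
  show ?thesis
  proof (rule that[of "Blinfun g"])
    show "Blinfun g \<in> clinear_ops"
      by (simp add: clinear_ops_def ap g_scale scaleC_complex_def)
    show "norm (Blinfun g) \<le> 1"
      by (rule norm_blinfun_bound) (use bound in \<open>auto simp: ap\<close>)
    have "Re (g x) = norm x" by (simp add: g_def fx)
    moreover have "(Re (g x))\<^sup>2 + (Im (g x))\<^sup>2 \<le> (norm x)\<^sup>2"
      using bound[of x] by (simp add: cmod_def real_le_lsqrt sqrt_le_D)
    ultimately show "blinfun_apply (Blinfun g) x = of_real (norm x)"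
      by (simp add: ap complex_eq_iff)
  qed
qed

section \<open>Rank one operators and biorthogonal systems\<close>

lemma clinear_opsD: "T \<in> clinear_ops \<Longrightarrow> blinfun_apply T (c *\<^sub>C x) = c *\<^sub>C blinfun_apply T x"
  by (simp add: clinear_ops_def)

lemma functional_scaleC: "\<phi> \<in> clinear_ops \<Longrightarrow> blinfun_apply \<phi> (c *\<^sub>C x) = c * blinfun_apply \<phi> x"
  by (simp add: clinear_ops_def scaleC_complex_def)

lemma bounded_linear_scaleC_left: "bounded_linear (\<lambda>c. c *\<^sub>C (x :: 'a::complex_banach))"
  by (rule bounded_linear_intro[where K = "norm x"])
    (simp_all add: scaleC_add_left norm_scaleC scaleC_of_real[symmetric] scaleC_complex_def)

definition rank_one :: "'b::complex_banach \<Rightarrow> ('a::complex_banach \<Rightarrow>\<^sub>L complex) \<Rightarrow> 'a \<Rightarrow>\<^sub>L 'b"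
  where "rank_one u \<psi> = Blinfun (\<lambda>x. \<psi> x *\<^sub>C u)"

lemma rank_one_apply [simp]: "blinfun_apply (rank_one u \<psi>) x = \<psi> x *\<^sub>C u"
  unfolding rank_one_def
  by (subst bounded_linear_Blinfun_apply)
    (auto intro: bounded_linear_compose[OF bounded_linear_scaleC_left] blinfun.bounded_linear_right)

lemma rank_one_clinear: "\<psi> \<in> clinear_ops \<Longrightarrow> rank_one u \<psi> \<in> clinear_ops"
  by (simp add: clinear_ops_def scaleC_complex_def scaleC_scaleC)

lemma norm_rank_one_le: "norm (rank_one u \<psi>) \<le> norm u * norm \<psi>"
proof (rule norm_blinfun_bound)
  show "norm (rank_one u \<psi> x) \<le> norm u * norm \<psi> * norm x" for x
    using mult_right_mono[OF norm_blinfun[of \<psi> x], of "norm u"]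
    by (simp add: norm_scaleC mult_ac)
qed simp

lemma clinear_ops_diff: "S \<in> clinear_ops \<Longrightarrow> T \<in> clinear_ops \<Longrightarrow> S - T \<in> clinear_ops"
  by (simp add: clinear_ops_def blinfun.diff_left complex_vector.scale_right_diff_distrib)

lemma clinear_ops_add: "S \<in> clinear_ops \<Longrightarrow> T \<in> clinear_ops \<Longrightarrow> S + T \<in> clinear_ops"
  by (simp add: clinear_ops_def blinfun.add_left scaleC_add_right)

lemma clinear_ops_scaleC: "T \<in> clinear_ops \<Longrightarrow> c *\<^sub>C T \<in> clinear_ops"
  by (simp add: clinear_ops_def blinfun_apply_scaleC scaleC_scaleC mult.commute)

lemma clinear_ops_compose: "S \<in> clinear_ops \<Longrightarrow> T \<in> clinear_ops \<Longrightarrow> S o\<^sub>L T \<in> clinear_ops"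
  by (simp add: clinear_ops_def)

lemma clinear_ops_zero: "0 \<in> clinear_ops"
  by (simp add: clinear_ops_def)

lemma clinear_ops_sum: "(\<And>i. i \<in> I \<Longrightarrow> T i \<in> clinear_ops) \<Longrightarrow> (\<Sum>i\<in>I. T i) \<in> clinear_ops"
  by (induction I rule: infinite_finite_induct) (auto simp: clinear_ops_zero clinear_ops_add)

text \<open>
  Only the first \<open>n\<close> members of the sequences are constrained, so that a system can be extended one step at
  a time by function update.
\<close>

definition biorthogonal :: "nat \<Rightarrow> (nat \<Rightarrow> 'a::complex_banach) \<Rightarrow> (nat \<Rightarrow> 'a \<Rightarrow>\<^sub>L complex) \<Rightarrow> bool"
  where "biorthogonal n u \<phi> \<longleftrightarrow> (\<forall>i<n. \<phi> i \<in> clinear_ops) \<and> (\<forall>i<n. \<forall>j<n. \<phi> i (u j) = (if i = j then 1 else 0))"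

text \<open>
  The projection onto the span of \<open>u 0, \<dots>, u (n - 1)\<close> that belongs to a biorthogonal system.
\<close>

definition finite_expansion :: "nat \<Rightarrow> (nat \<Rightarrow> 'a::complex_banach) \<Rightarrow> (nat \<Rightarrow> 'a \<Rightarrow>\<^sub>L complex) \<Rightarrow> 'a \<Rightarrow>\<^sub>L 'a"
  where "finite_expansion n u \<phi> = (\<Sum>i<n. rank_one (u i) (\<phi> i))"

lemma finite_expansion_apply: "finite_expansion n u \<phi> x = (\<Sum>i<n. \<phi> i x *\<^sub>C u i)"
  by (simp add: finite_expansion_def blinfun.sum_left)

lemma finite_expansion_basis:
  assumes "biorthogonal n u \<phi>" "j < n"
  shows "finite_expansion n u \<phi> (u j) = u j"
proof -
  have "finite_expansion n u \<phi> (u j) = (\<Sum>i<n. if i = j then u j else 0)"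
    unfolding finite_expansion_apply using assms by (intro sum.cong) (auto simp: biorthogonal_def)
  then show ?thesis using assms(2) by simp
qed

lemma finite_expansion_clinear: "biorthogonal n u \<phi> \<Longrightarrow> finite_expansion n u \<phi> \<in> clinear_ops"
  unfolding finite_expansion_def by (intro clinear_ops_sum rank_one_clinear) (simp add: biorthogonal_def)

lemma finite_expansion_idempotent:
  assumes b: "biorthogonal n u \<phi>"
  shows "finite_expansion n u \<phi> \<in> finite_rank_idempotents"
proof -
  let ?p = "finite_expansion n u \<phi>"
  have "?p o\<^sub>L ?p = ?p"
  proof (rule blinfun_eqI)
    fix x
    have "(?p o\<^sub>L ?p) x = (\<Sum>i<n. ?p (\<phi> i x *\<^sub>C u i))"
      by (simp add: finite_expansion_apply[of n u \<phi> x] blinfun.sum_right)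
    also have "\<dots> = (\<Sum>i<n. \<phi> i x *\<^sub>C u i)"
      using clinear_opsD[OF finite_expansion_clinear[OF b]] finite_expansion_basis[OF b]
      by (intro sum.cong) auto
    finally show "(?p o\<^sub>L ?p) x = ?p x" by (simp add: finite_expansion_apply)
  qed
  moreover have "range ?p \<subseteq> complex_vector.span (u ` {..<n})"
  proof (rule image_subsetI)
    show "?p x \<in> complex_vector.span (u ` {..<n})" for x
      unfolding finite_expansion_apply
      by (intro complex_vector.span_sum complex_vector.span_scale complex_vector.span_base imageI)
  qed
  ultimately show ?thesis
    unfolding finite_rank_idempotents_def finite_rank_ops_def
    using finite_expansion_clinear[OF b] by blast
qed

text \<open>
  Take \<open>v = x - p x \<noteq> 0\<close> for the projection \<open>p\<close> of the given system; then all \<open>\<phi> i\<close> vanish at \<open>v\<close>. A functional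
  that is nonzero at \<open>v\<close> becomes biorthogonal to the old vectors after composition with \<open>1 - p\<close>.
\<close>

lemma extend_biorthogonal:
  assumes b: "biorthogonal n u \<phi>" and ne: "finite_expansion n u \<phi> \<noteq> id_blinfun"
  shows "\<exists>v \<psi>. biorthogonal (Suc n) (u(n := v)) (\<phi>(n := \<psi>))"
proof -
  let ?p = "finite_expansion n u \<phi>"
  obtain x where x: "x - ?p x \<noteq> 0"
    using ne blinfun_eqI[of ?p id_blinfun] by fastforce
  define v where "v = x - ?p x"
  obtain \<psi>' :: "'a \<Rightarrow>\<^sub>L complex" where \<psi>': "\<psi>' \<in> clinear_ops" "\<psi>' v = of_real (norm v)"
    using norming_functional[of v] by blast
  define \<psi> where "\<psi> = inverse (of_real (norm v)) *\<^sub>C (\<psi>' - (\<psi>' o\<^sub>L ?p))"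
  have cl: "\<And>i. i < n \<Longrightarrow> \<phi> i \<in> clinear_ops" and bi: "\<And>i j. i < n \<Longrightarrow> j < n \<Longrightarrow> \<phi> i (u j) = (if i = j then 1 else 0)"
    using b unfolding biorthogonal_def by blast+
  note p_cl = finite_expansion_clinear[OF b] and pu = finite_expansion_basis[OF b]
  have \<phi>p: "\<phi> i (?p y) = \<phi> i y" if "i < n" for i y
  proof -
    have "\<phi> i (?p y) = (\<Sum>j<n. \<phi> j y * \<phi> i (u j))"
      by (simp add: finite_expansion_apply blinfun.sum_right functional_scaleC[OF cl[OF that]])
    also have "\<dots> = (\<Sum>j<n. if j = i then \<phi> i y else 0)"
      using bi that by (intro sum.cong) auto
    finally show ?thesis using that by simp
  qed
  have \<phi>v: "\<phi> i v = 0" if "i < n" for i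
    using \<phi>p[OF that] by (simp add: v_def blinfun.diff_right)
  have "?p v = 0"
    by (simp add: finite_expansion_apply \<phi>v)
  then have "\<psi> v = 1"
    using x \<psi>'(2) by (simp add: \<psi>_def blinfun_apply_scaleC blinfun.diff_left scaleC_complex_def v_def[symmetric])
  moreover have "\<psi> (u j) = 0" if "j < n" for j
    using pu[OF that] by (simp add: \<psi>_def blinfun_apply_scaleC blinfun.diff_left)
  moreover have "\<psi> \<in> clinear_ops"
    unfolding \<psi>_def by (intro clinear_ops_scaleC clinear_ops_diff clinear_ops_compose \<psi>' p_cl)
  ultimately have "biorthogonal (Suc n) (u(n := v)) (\<phi>(n := \<psi>))"
    using cl bi \<phi>v by (auto simp: biorthogonal_def less_Suc_eq)
  then show ?thesis by blast
qed

lemma biorthogonal_cases: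
  obtains (finite) n and u :: "nat \<Rightarrow> 'a::complex_banach" and \<phi> :: "nat \<Rightarrow> 'a \<Rightarrow>\<^sub>L complex"
    where "biorthogonal n u \<phi>" "finite_expansion n u \<phi> = id_blinfun"
  | (infinite) u :: "nat \<Rightarrow> 'a::complex_banach" and \<phi> :: "nat \<Rightarrow> 'a \<Rightarrow>\<^sub>L complex"
    where "\<And>n. biorthogonal n u \<phi>"
proof (cases "\<exists>n (u :: nat \<Rightarrow> 'a) \<phi>. biorthogonal n u \<phi> \<and> finite_expansion n u \<phi> = id_blinfun")
  case True
  then show ?thesis using finite by blast
next
  case False
  let ?step = "\<lambda>n x y. \<exists>v \<psi>. y = ((fst x)(n := v), (snd x)(n := \<psi>))"
  have "\<exists>f. \<forall>n. (case f n of (u :: nat \<Rightarrow> 'a, \<phi>) \<Rightarrow> biorthogonal n u \<phi>) \<and> ?step n (f n) (f (Suc n))"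
  proof (rule dependent_nat_choice)
    show "\<exists>x. case x of (u :: nat \<Rightarrow> 'a, \<phi>) \<Rightarrow> biorthogonal 0 u \<phi>"
      by (simp add: biorthogonal_def)
    fix x :: "(nat \<Rightarrow> 'a) \<times> (nat \<Rightarrow> 'a \<Rightarrow>\<^sub>L complex)" and n
    assume "case x of (u, \<phi>) \<Rightarrow> biorthogonal n u \<phi>"
    then have "biorthogonal n (fst x) (snd x)" by (simp add: case_prod_beta)
    with False extend_biorthogonal[of n "fst x" "snd x"]
    obtain v \<psi> where "biorthogonal (Suc n) ((fst x)(n := v)) ((snd x)(n := \<psi>))" by blast
    then show "\<exists>y. (case y of (u, \<phi>) \<Rightarrow> biorthogonal (Suc n) u \<phi>) \<and> ?step n x y" by auto
  qed
  then obtain f where f: "\<And>n. biorthogonal n (fst (f n)) (snd (f n :: (nat \<Rightarrow> 'a) \<times> _))"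
    and step: "\<And>n. ?step n (f n) (f (Suc n))"
    by (auto simp: case_prod_beta)
  define u where "u n = fst (f (Suc n)) n" for n
  define \<phi> where "\<phi> n = snd (f (Suc n)) n" for n
  have agree: "fst (f n) i = u i \<and> snd (f n) i = \<phi> i" if "i < n" for i n
    using that
  proof (induction n)
    case (Suc n)
    show ?case
    proof (cases "i = n")
      case False
      then have "fst (f (Suc n)) i = fst (f n) i" "snd (f (Suc n)) i = snd (f n) i"
        using step[of n] by auto
      with Suc False show ?thesis by simp
    qed (simp add: u_def \<phi>_def)
  qed simp
  have "biorthogonal n u \<phi>" for n
    using f[of n] agree[of _ n] by (simp add: biorthogonal_def)
  then show ?thesis using infinite by blast
qed

section \<open>Weak measurability over a separable space\<close>

lemma tendsto_if_norm_diff_small: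
  fixes x :: "'a::real_normed_vector"
  assumes "\<And>k. norm (x - y k) < inverse (real (Suc k))"
  shows "y \<longlonglongrightarrow> x"
proof (rule metric_tendsto_imp_tendsto[OF LIMSEQ_inverse_real_of_nat])
  have "dist (y k) x \<le> dist (inverse (real (Suc k))) 0" for k
    using assms[of k] by (simp add: dist_norm norm_minus_commute)
  then show "\<forall>\<^sub>F k in sequentially. dist (y k) x \<le> dist (inverse (real (Suc k))) 0"
    by simp
qed

locale norming_sequences =
  fixes D :: "nat \<Rightarrow> 'x::complex_banach" and \<Psi> :: "nat \<Rightarrow> 'x \<Rightarrow>\<^sub>L complex"
  assumes dense: "closure (range D) = UNIV"
    and \<Psi>_clinear: "\<Psi> i \<in> clinear_ops"
    and norm_\<Psi>_le: "norm (\<Psi> i) \<le> 1"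
    and \<Psi>_D: "\<Psi> i (D i) = of_real (norm (D i))"

lemma exists_norming_sequences:
  assumes "separable_space (euclidean :: 'x::complex_banach topology)"
  shows "\<exists>(D :: nat \<Rightarrow> 'x) \<Psi>. norming_sequences D \<Psi>"
proof -
  obtain C :: "'x set" where C: "countable C" "closure C = UNIV"
    using assms by (auto simp: separable_space_def euclidean_closure_of)
  then have "C \<noteq> {}" by auto
  with C have "range (from_nat_into C) = C" by (simp add: range_from_nat_into)
  moreover have "\<exists>\<psi> :: 'x \<Rightarrow>\<^sub>L complex. \<psi> \<in> clinear_ops \<and> norm \<psi> \<le> 1 \<and> blinfun_apply \<psi> x = of_real (norm x)" for x :: 'x
  proof -
    obtain \<psi> :: "'x \<Rightarrow>\<^sub>L complex" where "\<psi> \<in> clinear_ops" "norm \<psi> \<le> 1" "\<psi> x = of_real (norm x)"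
      by (rule norming_functional)
    then show ?thesis by blast
  qed
  then have "\<forall>x :: 'x. \<exists>\<psi> :: 'x \<Rightarrow>\<^sub>L complex. \<psi> \<in> clinear_ops \<and> norm \<psi> \<le> 1 \<and> blinfun_apply \<psi> x = of_real (norm x)"
    by blast
  from choice[OF this] obtain \<psi> :: "'x \<Rightarrow> 'x \<Rightarrow>\<^sub>L complex"
    where "\<forall>x :: 'x. \<psi> x \<in> clinear_ops \<and> norm (\<psi> x) \<le> 1 \<and> blinfun_apply (\<psi> x) x = of_real (norm x)" ..
  ultimately have "norming_sequences (from_nat_into C) (\<lambda>i. \<psi> (from_nat_into C i))"
    using C by unfold_locales auto
  then show ?thesis by blast
qed

definition weakly_measurable :: "'s measure \<Rightarrow> ('s \<Rightarrow> 'x::complex_banach) set"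
  where "weakly_measurable M = {y. \<forall>\<phi>\<in>clinear_ops. (\<lambda>s. blinfun_apply \<phi> (y s) :: complex) \<in> borel_measurable M}"

lemma weakly_measurableD:
  "y \<in> weakly_measurable M \<Longrightarrow> \<phi> \<in> clinear_ops \<Longrightarrow> (\<lambda>s. blinfun_apply \<phi> (y s) :: complex) \<in> borel_measurable M"
  by (simp add: weakly_measurable_def)

lemma wo_measurable_iff:
  "f \<in> wo_measurable M clinear_ops \<longleftrightarrow>
    (\<forall>s\<in>space M. f s \<in> clinear_ops) \<and> (\<forall>x. (\<lambda>s. blinfun_apply (f s) x) \<in> weakly_measurable M)"
  by (auto simp: wo_measurable_def weakly_measurable_def)

lemma weakly_measurable_const: "(\<lambda>s. x) \<in> weakly_measurable M"
  by (simp add: weakly_measurable_def)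

lemma weakly_measurable_add:
  "y \<in> weakly_measurable M \<Longrightarrow> z \<in> weakly_measurable M \<Longrightarrow> (\<lambda>s. y s + z s) \<in> weakly_measurable M"
  by (auto simp: weakly_measurable_def blinfun.add_right intro: borel_measurable_add)

lemma weakly_measurable_diff:
  "y \<in> weakly_measurable M \<Longrightarrow> z \<in> weakly_measurable M \<Longrightarrow> (\<lambda>s. y s - z s) \<in> weakly_measurable M"
  by (auto simp: weakly_measurable_def blinfun.diff_right intro: borel_measurable_diff)

lemma weakly_measurable_scaleC:
  "a \<in> borel_measurable M \<Longrightarrow> y \<in> weakly_measurable M \<Longrightarrow> (\<lambda>s. a s *\<^sub>C y s) \<in> weakly_measurable M"
  by (auto simp: weakly_measurable_def functional_scaleC intro: borel_measurable_times)

lemma weakly_measurable_sum: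
  fixes n :: nat
  assumes "\<And>i. y i \<in> weakly_measurable M"
  shows "(\<lambda>s. \<Sum>i<n. y i s) \<in> weakly_measurable M"
  by (induction n) (auto intro: assms weakly_measurable_add weakly_measurable_const)

text \<open>
  Functions that select among countably many measurable functions; this is how vectors and operators
  depending on \<open>s\<close> are chosen measurably throughout.
\<close>

lemma weakly_measurable_countable_index:
  fixes j :: "'s \<Rightarrow> 'i::countable" and y :: "'i \<Rightarrow> 's \<Rightarrow> 'x::complex_banach"
  assumes "\<And>i. y i \<in> weakly_measurable M" "j \<in> measurable M (count_space UNIV)"
  shows "(\<lambda>s. y (j s) s) \<in> weakly_measurable M"
  unfolding weakly_measurable_def
proof (intro CollectI ballI)
  fix \<phi> :: "'x \<Rightarrow>\<^sub>L complex"
  assume "\<phi> \<in> clinear_ops"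
  then have "(\<lambda>s. blinfun_apply \<phi> (y i s)) \<in> borel_measurable M" for i
    using assms(1) by (rule weakly_measurableD[rotated])
  then show "(\<lambda>s. blinfun_apply \<phi> (y (j s) s)) \<in> borel_measurable M"
    by (rule measurable_compose_countable[of "\<lambda>i s. blinfun_apply \<phi> (y i s)", OF _ assms(2)])
qed

lemma weakly_measurable_LIMSEQ:
  fixes y :: "nat \<Rightarrow> 's \<Rightarrow> 'x::complex_banach"
  assumes y: "\<And>k. y k \<in> weakly_measurable M" and lim: "\<And>s. s \<in> space M \<Longrightarrow> (\<lambda>k. y k s) \<longlonglongrightarrow> z s"
  shows "z \<in> weakly_measurable M"
  unfolding weakly_measurable_def
proof (intro CollectI ballI)
  fix \<phi> :: "'x \<Rightarrow>\<^sub>L complex"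
  assume "\<phi> \<in> clinear_ops"
  then have meas: "(\<lambda>s. blinfun_apply \<phi> (y k s)) \<in> borel_measurable M" for k
    using y by (rule weakly_measurableD[rotated])
  show "(\<lambda>s. blinfun_apply \<phi> (z s)) \<in> borel_measurable M"
    by (rule borel_measurable_LIMSEQ_metric[of "\<lambda>k s. blinfun_apply \<phi> (y k s)", OF meas]) (intro blinfun.tendsto tendsto_const lim)
qed

context norming_sequences
begin

lemma dense_approx: "0 < e \<Longrightarrow> \<exists>i. norm (x - D i) < e"
  using dense closure_approachable[of x "range D"] by (auto simp: dist_norm norm_minus_commute)

lemma norm_le_iff_\<Psi>: "norm x \<le> c \<longleftrightarrow> (\<forall>i. cmod (\<Psi> i x) \<le> c)"
proof (intro iffI allI)
  fix i
  assume "norm x \<le> c"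
  moreover have "cmod (\<Psi> i x) \<le> norm (\<Psi> i) * norm x" by (rule norm_blinfun)
  moreover have "norm (\<Psi> i) * norm x \<le> 1 * norm x" by (intro mult_right_mono norm_\<Psi>_le) auto
  ultimately show "cmod (\<Psi> i x) \<le> c" by linarith
next
  assume *: "\<forall>i. cmod (\<Psi> i x) \<le> c"
  show "norm x \<le> c"
  proof (rule field_le_epsilon)
    fix e :: real
    assume "0 < e"
    then obtain i where i: "norm (x - D i) < e / 2"
      using dense_approx[of "e / 2"] by auto
    have "norm (D i) = cmod (\<Psi> i (D i))" by (simp add: \<Psi>_D)
    also have "\<Psi> i (D i) = \<Psi> i x - \<Psi> i (x - D i)" by (simp add: blinfun.diff_right)
    also have "cmod \<dots> \<le> cmod (\<Psi> i x) + cmod (\<Psi> i (x - D i))" by (rule norm_triangle_ineq4)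
    also have "cmod (\<Psi> i (x - D i)) \<le> norm (\<Psi> i) * norm (x - D i)" by (rule norm_blinfun)
    also have "\<dots> \<le> 1 * norm (x - D i)" by (intro mult_right_mono norm_\<Psi>_le) auto
    finally have "norm (D i) \<le> c + e / 2" using i *[rule_format, of i] by simp
    then show "norm x \<le> c + e"
      using i norm_triangle_ineq2[of x "D i"] by simp
  qed
qed

lemma eq_if_\<Psi>_eq: "(\<And>i. \<Psi> i x = \<Psi> i y) \<Longrightarrow> x = y"
  using norm_le_iff_\<Psi>[of "x - y" 0] by (simp add: blinfun.diff_right)

lemma dense_sequence:
  obtains r :: "nat \<Rightarrow> nat" where "(\<lambda>k. D (r k)) \<longlonglongrightarrow> x"
proof -
  have "\<forall>k. \<exists>i. norm (x - D i) < inverse (real (Suc k))"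
    by (intro allI dense_approx) simp
  then obtain r where "\<And>k. norm (x - D (r k)) < inverse (real (Suc k))" by metis
  then have "(\<lambda>k. D (r k)) \<longlonglongrightarrow> x"
    by (rule tendsto_if_norm_diff_small)
  then show ?thesis by (rule that)
qed

lemma closed_contains_all: "closed S \<Longrightarrow> (\<And>i. D i \<in> S) \<Longrightarrow> x \<in> S"
  using dense closure_minimal[of "range D" S] by auto

lemma eq_on_dense:
  assumes "continuous_on UNIV f" "continuous_on UNIV g" "\<And>i. f (D i) = (g (D i) :: 'c::real_normed_vector)"
  shows "f x = g x"
proof -
  have "closed {x. f x = g x}"
    using assms by (intro closed_Collect_eq)
  from closed_contains_all[OF this] assms(3) show ?thesis by blast
qed

lemma blinfun_eq_on_dense: "(\<And>i. blinfun_apply S (D i) = blinfun_apply T (D i)) \<Longrightarrow> S = T"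
  by (rule blinfun_eqI, rule eq_on_dense)
    (simp_all add: linear_continuous_on[OF blinfun.bounded_linear_right])

lemma norm_blinfun_le_iff_dense:
  assumes "0 \<le> c"
  shows "norm T \<le> c \<longleftrightarrow> (\<forall>i. norm (blinfun_apply T (D i)) \<le> c * norm (D i))"
proof (intro iffI allI)
  fix i
  assume "norm T \<le> c"
  then have "norm T * norm (D i) \<le> c * norm (D i)"
    by (rule mult_right_mono) simp
  with norm_blinfun[of T "D i"] show "norm (blinfun_apply T (D i)) \<le> c * norm (D i)"
    by (rule order_trans)
next
  assume *: "\<forall>i. norm (blinfun_apply T (D i)) \<le> c * norm (D i)"
  show "norm T \<le> c"
  proof (rule norm_blinfun_bound[OF assms])
    fix x
    have "closed {x. norm (blinfun_apply T x) \<le> c * norm x}"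
      by (intro closed_Collect_le continuous_on_norm continuous_on_mult_left continuous_on_id
        linear_continuous_on[OF blinfun.bounded_linear_right])
    from closed_contains_all[OF this] * show "norm (blinfun_apply T x) \<le> c * norm x" by blast
  qed
qed

lemma borel_measurable_norm_weakly:
  assumes "y \<in> weakly_measurable M"
  shows "(\<lambda>s. norm (y s :: 'x)) \<in> borel_measurable M"
proof (rule borel_measurable_iff_le[THEN iffD2], rule allI)
  fix c
  have [measurable]: "(\<lambda>s. \<Psi> i (y s)) \<in> borel_measurable M" for i
    by (rule weakly_measurableD[OF assms \<Psi>_clinear])
  have "{s \<in> space M. norm (y s) \<le> c} = {s \<in> space M. \<forall>i. cmod (\<Psi> i (y s)) \<le> c}"
    using norm_le_iff_\<Psi> by blast
  also have "\<dots> \<in> sets M" by measurable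
  finally show "{s \<in> space M. norm (y s) \<le> c} \<in> sets M" .
qed

lemma borel_measurable_opnorm:
  assumes f: "\<And>x :: 'x. (\<lambda>s. blinfun_apply (f s) x :: 'x) \<in> weakly_measurable M"
  shows "(\<lambda>s. norm (f s)) \<in> borel_measurable M"
proof (rule borel_measurable_iff_le[THEN iffD2], rule allI)
  fix c
  have [measurable]: "(\<lambda>s. norm (blinfun_apply (f s) x)) \<in> borel_measurable M" for x
    by (rule borel_measurable_norm_weakly[OF f])
  show "{s \<in> space M. norm (f s) \<le> c} \<in> sets M"
  proof (cases "0 \<le> c")
    case True
    have "{s \<in> space M. norm (f s) \<le> c} = {s \<in> space M. \<forall>i. norm (blinfun_apply (f s) (D i)) \<le> c * norm (D i)}"
      using norm_blinfun_le_iff_dense[OF True] by blast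
    also have "\<dots> \<in> sets M" by measurable
    finally show ?thesis .
  next
    case False
    then have "{s \<in> space M. norm (f s) \<le> c} = {}"
      using norm_ge_zero[THEN order_trans] by blast
    then show ?thesis by (simp only: sets.empty_sets)
  qed
qed

text \<open>
  The argument \<open>y\<close> is the limit of the functions that pick the first member of the dense sequence
  within distance \<open>1 / (k + 1)\<close>; for such countably valued arguments the claim is clear. Measurability of pointwise
  products is a consequence.
\<close>

lemma weakly_measurable_apply:
  assumes f: "\<And>x :: 'x. (\<lambda>s. blinfun_apply (f s) x :: 'x) \<in> weakly_measurable M" and y: "y \<in> weakly_measurable M"
  shows "(\<lambda>s. blinfun_apply (f s) (y s)) \<in> weakly_measurable M"
proof -
  define r where "r k s = (LEAST i. norm (y s - D i) < inverse (real (Suc k)))" for k s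
  have [measurable]: "(\<lambda>s. norm (y s - D i)) \<in> borel_measurable M" for i
    by (intro borel_measurable_norm_weakly weakly_measurable_diff y weakly_measurable_const)
  have "r k \<in> measurable M (count_space UNIV)" for k
    unfolding r_def by measurable
  then have "(\<lambda>s. blinfun_apply (f s) (D (r k s))) \<in> weakly_measurable M" for k
    by (rule weakly_measurable_countable_index[of "\<lambda>i s. blinfun_apply (f s) (D i)", OF f])
  moreover have "(\<lambda>k. blinfun_apply (f s) (D (r k s))) \<longlonglongrightarrow> blinfun_apply (f s) (y s)" for s
  proof (intro blinfun.tendsto tendsto_const)
    have "norm (y s - D (r k s)) < inverse (real (Suc k))" for k
      unfolding r_def by (rule LeastI_ex[OF dense_approx]) simp
    then show "(\<lambda>k. D (r k s)) \<longlonglongrightarrow> y s"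
      by (rule tendsto_if_norm_diff_small)
  qed
  ultimately show ?thesis by (rule weakly_measurable_LIMSEQ)
qed

end

section \<open>Calculus of classes\<close>

abbreviation wom :: "'s measure \<Rightarrow> ('s \<Rightarrow> 'x::complex_banach \<Rightarrow>\<^sub>L 'x) set"
  where "wom M \<equiv> wo_measurable M clinear_ops"

lemma wom_const: "T \<in> clinear_ops \<Longrightarrow> (\<lambda>s. T) \<in> wom M"
  by (simp add: wo_measurable_iff weakly_measurable_const)

lemma wom_add: "f \<in> wom M \<Longrightarrow> g \<in> wom M \<Longrightarrow> (\<lambda>s. f s + g s) \<in> wom M"
  by (simp add: wo_measurable_iff clinear_ops_add blinfun.add_left weakly_measurable_add)

lemma wom_diff: "f \<in> wom M \<Longrightarrow> g \<in> wom M \<Longrightarrow> (\<lambda>s. f s - g s) \<in> wom M"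
  by (simp add: wo_measurable_iff clinear_ops_diff blinfun.diff_left weakly_measurable_diff)

lemma wom_scaleC: "a \<in> borel_measurable M \<Longrightarrow> f \<in> wom M \<Longrightarrow> (\<lambda>s. a s *\<^sub>C f s) \<in> wom M"
  by (simp add: wo_measurable_iff clinear_ops_scaleC blinfun_apply_scaleC weakly_measurable_scaleC)

lemma (in norming_sequences) wom_compose:
  "f \<in> wom M \<Longrightarrow> g \<in> wom M \<Longrightarrow> (\<lambda>s. f s o\<^sub>L g s :: 'x \<Rightarrow>\<^sub>L 'x) \<in> wom M"
  by (simp add: wo_measurable_iff clinear_ops_compose weakly_measurable_apply)

lemma wo_class_eq_iff: "f \<in> wom M \<Longrightarrow> g \<in> wom M \<Longrightarrow> wo_class M f = wo_class M g \<longleftrightarrow> (AE s in M. f s = g s)"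
  unfolding wo_class_def by (subst eq_equiv_class_iff[OF equiv_ae_rel]) (auto simp: ae_rel_def)

lemma mem_wo_class: "g \<in> wo_class M f \<longleftrightarrow> f \<in> wom M \<and> g \<in> wom M \<and> (AE s in M. f s = g s)"
  by (simp add: wo_class_def ae_rel_def)

lemma L0_woE:
  assumes "F \<in> L0_wo M clinear_ops"
  obtains f where "f \<in> wom M" "F = wo_class M f"
  using assms by (auto simp: L0_wo_def wo_class_def elim: quotientE)

lemma wo_class_in_L0_wo: "f \<in> wom M \<Longrightarrow> wo_class M f \<in> L0_wo M clinear_ops"
  by (simp add: L0_wo_def wo_class_def quotientI)

lemma wo_lift2_class:
  assumes f: "f \<in> wom M" and g: "g \<in> wom M"
    and h: "\<And>f g. f \<in> wom M \<Longrightarrow> g \<in> wom M \<Longrightarrow> (\<lambda>s. h (f s) (g s)) \<in> wom M"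
  shows "wo_lift2 h M (wo_class M f) (wo_class M g) = wo_class M (\<lambda>s. h (f s) (g s))"
proof -
  have "wo_class M (\<lambda>s. h (f' s) (g' s)) = wo_class M (\<lambda>s. h (f s) (g s))"
    if "f' \<in> wo_class M f" "g' \<in> wo_class M g" for f' g'
  proof -
    have *: "f' \<in> wom M" "g' \<in> wom M" "AE s in M. f s = f' s" "AE s in M. g s = g' s"
      using that by (auto simp: mem_wo_class)
    from *(3,4) have "AE s in M. h (f' s) (g' s) = h (f s) (g s)"
      by eventually_elim simp
    then show ?thesis
      using * f g by (simp add: wo_class_eq_iff h)
  qed
  moreover have "f \<in> wo_class M f" "g \<in> wo_class M g"
    using f g by (auto simp: mem_wo_class)
  ultimately show ?thesis
    unfolding wo_lift2_def by blast
qed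

lemma wo_add_class:
  "f \<in> wom M \<Longrightarrow> g \<in> wom M \<Longrightarrow> wo_add M (wo_class M f) (wo_class M g) = wo_class M (\<lambda>s. f s + g s)"
  unfolding wo_add_def by (intro wo_lift2_class wom_add)

lemma wo_diff_class:
  "f \<in> wom M \<Longrightarrow> g \<in> wom M \<Longrightarrow> wo_diff M (wo_class M f) (wo_class M g) = wo_class M (\<lambda>s. f s - g s)"
  unfolding wo_diff_def by (intro wo_lift2_class wom_diff)

lemma (in norming_sequences) wo_mult_class:
  "f \<in> wom M \<Longrightarrow> g \<in> wom M \<Longrightarrow>
    wo_mult M (wo_class M f) (wo_class M g) = wo_class M (\<lambda>s. f s o\<^sub>L g s :: 'x \<Rightarrow>\<^sub>L 'x)"
  unfolding wo_mult_def by (intro wo_lift2_class wom_compose)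

lemma wo_scale_class:
  assumes f: "f \<in> wom M" and a: "a \<in> borel_measurable M"
  shows "wo_scale M a (wo_class M f) = wo_class M (\<lambda>s. a s *\<^sub>C f s)"
proof -
  have "wo_class M (\<lambda>s. a s *\<^sub>C f' s) = wo_class M (\<lambda>s. a s *\<^sub>C f s)" if "f' \<in> wo_class M f" for f'
  proof -
    have *: "f' \<in> wom M" "AE s in M. f s = f' s"
      using that by (auto simp: mem_wo_class)
    from *(2) have "AE s in M. a s *\<^sub>C f' s = a s *\<^sub>C f s"
      by eventually_elim simp
    then show ?thesis
      using * f a by (simp add: wo_class_eq_iff wom_scaleC)
  qed
  moreover have "f \<in> wo_class M f"
    using f by (auto simp: mem_wo_class)
  ultimately show ?thesis
    unfolding wo_scale_def by blast
qed

lemma (in norming_sequences) wo_norm_class_le: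
  assumes f: "f \<in> wom M" and le: "\<And>s. s \<in> space M \<Longrightarrow> norm (f s :: 'x \<Rightarrow>\<^sub>L 'x) \<le> c"
  shows "wo_norm M (wo_class M f) \<le> ennreal c"
proof -
  have meas: "(\<lambda>s. ennreal (norm (g s))) \<in> borel_measurable M" if "g \<in> wom M" for g :: "_ \<Rightarrow> 'x \<Rightarrow>\<^sub>L 'x"
    using that by (intro measurable_compose[OF _ measurable_ennreal] borel_measurable_opnorm)
      (simp add: wo_measurable_iff)
  have "esssup M (\<lambda>s. ennreal (norm (g s))) = esssup M (\<lambda>s. ennreal (norm (f s)))"
    if "g \<in> wo_class M f" for g
  proof (rule esssup_AE_cong)
    have "AE s in M. f s = g s" using that by (simp add: mem_wo_class)
    then show "AE s in M. ennreal (norm (g s)) = ennreal (norm (f s))"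
      by eventually_elim simp
    show "(\<lambda>s. ennreal (norm (g s))) \<in> borel_measurable M" "(\<lambda>s. ennreal (norm (f s))) \<in> borel_measurable M"
      using that f by (auto intro!: meas simp only: mem_wo_class)
  qed
  moreover have "f \<in> wo_class M f"
    using f by (auto simp: mem_wo_class)
  ultimately have "(\<lambda>f. esssup M (\<lambda>s. ennreal (norm (f s)))) ` wo_class M f = {esssup M (\<lambda>s. ennreal (norm (f s)))}"
    by blast
  then have "wo_norm M (wo_class M f) = esssup M (\<lambda>s. ennreal (norm (f s)))"
    by (simp add: wo_norm_def)
  also have "\<dots> \<le> ennreal c"
    using le by (intro esssup_I meas f AE_I2 ennreal_leI)
  finally show ?thesis .
qed

lemma bounded_in_Linf:
  assumes "a \<in> borel_measurable M" "\<And>s. s \<in> space M \<Longrightarrow> cmod (a s) \<le> c"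
  shows "a \<in> Linf M"
proof -
  have "esssup M (\<lambda>s. ennreal (cmod (a s))) \<le> ennreal c"
    using assms by (intro esssup_I AE_I2 ennreal_leI) auto
  then show ?thesis
    using assms(1) by (auto simp: Linf_def intro: order_le_less_trans)
qed

section \<open>Series along a biorthogonal system\<close>

text \<open>
  The operator \<open>\<Sum>\<^sub>n y\<^sub>n \<otimes> \<phi>\<^sub>n\<close> of the gliding hump argument. Under the geometric bound assumed next it
  converges in operator norm, and its remainders after composition with \<open>1 - p\<^sub>n\<close>, where \<open>p\<^sub>n\<close> is the
  projection \<open>finite_expansion n u \<phi>\<close>, are small independently of the choice of \<open>y\<close>.
\<close>

definition series_operator :: "(nat \<Rightarrow> 'x::complex_banach) \<Rightarrow> (nat \<Rightarrow> 'x \<Rightarrow>\<^sub>L complex) \<Rightarrow> 'x \<Rightarrow>\<^sub>L 'x"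
  where "series_operator y \<phi> = (\<Sum>n. rank_one (y n) (\<phi> n))"

context
  fixes y :: "nat \<Rightarrow> 'x::complex_banach" and \<phi> :: "nat \<Rightarrow> 'x \<Rightarrow>\<^sub>L complex"
  assumes bound: "\<And>n. norm (y n) * norm (\<phi> n) \<le> (1 / 2) ^ n"
begin

lemma norm_rank_one_geometric: "norm (rank_one (y n) (\<phi> n)) \<le> (1 / 2) ^ n"
  by (rule order_trans[OF norm_rank_one_le bound])

lemma summable_rank_one: "summable (\<lambda>n. rank_one (y n) (\<phi> n))"
  by (rule summable_comparison_test'[where g = "\<lambda>n. (1 / 2) ^ n" and N = 0])
    (auto intro: norm_rank_one_geometric summable_geometric)

lemma series_operator_sums: "(\<lambda>n. \<phi> n x *\<^sub>C y n) sums series_operator y \<phi> x"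
  using bounded_linear.sums[OF blinfun.bounded_linear_left summable_sums[OF summable_rank_one], of x]
  by (simp add: series_operator_def)

lemma norm_series_operator_tail: "norm (\<Sum>k. rank_one (y (k + n)) (\<phi> (k + n))) \<le> 2 * (1 / 2) ^ n"
proof -
  have "norm (\<Sum>k. rank_one (y (k + n)) (\<phi> (k + n))) \<le> (\<Sum>k. (1 / 2) ^ (k + n))"
    by (rule norm_suminf_le)
      (auto intro: norm_rank_one_geometric summable_ignore_initial_segment[of "\<lambda>k. (1 / 2) ^ k"] summable_geometric)
  also have "\<dots> = (\<Sum>k. (1 / 2) ^ k) * (1 / 2 :: real) ^ n"
    by (simp only: power_add) (rule suminf_mult2[symmetric], simp add: summable_geometric)
  also have "(\<Sum>k. (1 / 2 :: real) ^ k) = 2"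
    by (subst suminf_geometric) auto
  finally show ?thesis .
qed

lemma norm_series_operator_le: "norm (series_operator y \<phi>) \<le> 2"
  using norm_series_operator_tail[of 0] by (simp add: series_operator_def)

lemma series_operator_clinear:
  assumes "\<And>n. \<phi> n \<in> clinear_ops"
  shows "series_operator y \<phi> \<in> clinear_ops"
  unfolding clinear_ops_def
proof (intro CollectI allI)
  fix c x
  have "(\<lambda>n. c *\<^sub>C \<phi> n x *\<^sub>C y n) sums (c *\<^sub>C series_operator y \<phi> x)"
    by (rule bounded_linear.sums[OF bounded_linear_scaleC series_operator_sums])
  moreover have "(\<lambda>n. c *\<^sub>C \<phi> n x *\<^sub>C y n) = (\<lambda>n. \<phi> n (c *\<^sub>C x) *\<^sub>C y n)"
    by (simp add: functional_scaleC[OF assms])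
  ultimately show "series_operator y \<phi> (c *\<^sub>C x) = c *\<^sub>C series_operator y \<phi> x"
    using series_operator_sums[of "c *\<^sub>C x"] sums_unique2 by metis
qed

context
  fixes u :: "nat \<Rightarrow> 'x"
  assumes biorth: "\<And>n. biorthogonal n u \<phi>"
begin

lemma biorthogonal_apply: "\<phi> i (u j) = (if i = j then 1 else 0)"
  using biorth[of "Suc (max i j)"] by (simp add: biorthogonal_def less_Suc_eq_le)

lemma series_operator_basis: "series_operator y \<phi> (u n) = y n"
proof -
  have "(\<lambda>m. \<phi> m (u n) *\<^sub>C y m) = (\<lambda>m. if m = n then y m else 0)"
    by (auto simp: biorthogonal_apply)
  then show ?thesis
    using series_operator_sums[of "u n"] sums_single[of n y] sums_unique2 by metis
qed

lemma norm_series_operator_remainder: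
  "norm (series_operator y \<phi> o\<^sub>L (id_blinfun - finite_expansion n u \<phi>)) \<le> 2 * (1 / 2) ^ n"
proof -
  have cl: "series_operator y \<phi> \<in> clinear_ops"
    using biorth[of "Suc _"] by (intro series_operator_clinear) (auto simp: biorthogonal_def)
  have "series_operator y \<phi> o\<^sub>L (id_blinfun - finite_expansion n u \<phi>)
      = series_operator y \<phi> - (\<Sum>i<n. rank_one (y i) (\<phi> i))"
    by (rule blinfun_eqI)
      (simp add: blinfun.diff_left blinfun.diff_right blinfun.sum_left finite_expansion_apply blinfun.sum_right
        clinear_opsD[OF cl] series_operator_basis)
  also have "\<dots> = (\<Sum>k. rank_one (y (k + n)) (\<phi> (k + n)))"
    by (simp add: series_operator_def suminf_minus_initial_segment[OF summable_rank_one])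
  finally show ?thesis using norm_series_operator_tail by simp
qed

end

end

section \<open>The derivation on representatives\<close>

text \<open>
  \<open>uniformly_compact_in\<close> is the compactness condition of admissibility. It concerns bounded functions \<open>f\<close> that are
  approximated, uniformly on the measure space, by \<open>f p\<close> with a finite rank idempotent \<open>p\<close>.
\<close>

locale admissible_derivation = norming_sequences D \<Psi>
  for D :: "nat \<Rightarrow> 'x::complex_banach" and \<Psi> :: "nat \<Rightarrow> 'x \<Rightarrow>\<^sub>L complex" +
  fixes M :: "'s measure"
    and A :: "('s \<Rightarrow> 'x \<Rightarrow>\<^sub>L 'x) set set"
    and \<delta> :: "('s \<Rightarrow> 'x \<Rightarrow>\<^sub>L 'x) set \<Rightarrow> ('s \<Rightarrow> 'x \<Rightarrow>\<^sub>L 'x) set"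
  assumes subalgebra: "wo_subalgebra M A"
    and Linf_module: "\<And>g F. g \<in> Linf M \<Longrightarrow> F \<in> A \<Longrightarrow> wo_scale M g F \<in> A"
    and uniformly_compact_in: "\<And>F E. F \<in> Linf_wo M clinear_ops \<Longrightarrow>
      (\<And>\<epsilon>::real. \<epsilon> > 0 \<Longrightarrow> \<exists>p\<in>finite_rank_idempotents.
        wo_norm M (wo_mult M F (wo_const M (id_blinfun - p))) \<le> ennreal \<epsilon>) \<Longrightarrow>
      E \<in> sets M \<Longrightarrow> emeasure M E < \<infinity> \<Longrightarrow> wo_scale M (indicator E) F \<in> A"
    and derivation: "wo_derivation M A \<delta>"
    and Linf_linear: "Linf_linear_on M A \<delta>"
begin

text \<open>
  The algebra and the derivation are transported from classes to representatives: \<open>alg\<close> contains every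
  representative of every class in \<open>A\<close>, and \<open>der f\<close> is an arbitrary representative of the image of the
  class of \<open>f\<close>. Identities for \<open>der\<close> therefore hold almost everywhere.
\<close>

definition alg :: "('s \<Rightarrow> 'x \<Rightarrow>\<^sub>L 'x) set"
  where "alg = {f \<in> wom M. wo_class M f \<in> A}"

definition der :: "('s \<Rightarrow> 'x \<Rightarrow>\<^sub>L 'x) \<Rightarrow> 's \<Rightarrow> 'x \<Rightarrow>\<^sub>L 'x"
  where "der f = (SOME g. g \<in> wom M \<and> wo_class M g = \<delta> (wo_class M f))"

lemma alg_wom: "f \<in> alg \<Longrightarrow> f \<in> wom M"
  by (simp add: alg_def)

lemma alg_clinear: "f \<in> alg \<Longrightarrow> s \<in> space M \<Longrightarrow> f s \<in> clinear_ops"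
  by (simp add: alg_def wo_measurable_iff)

lemma der_class: "f \<in> alg \<Longrightarrow> der f \<in> wom M \<and> wo_class M (der f) = \<delta> (wo_class M f)"
proof -
  assume "f \<in> alg"
  then have "\<delta> (wo_class M f) \<in> A"
    using derivation by (auto simp: wo_derivation_def alg_def)
  then have "\<delta> (wo_class M f) \<in> L0_wo M clinear_ops"
    using subalgebra by (auto simp: wo_subalgebra_def)
  then obtain g where "g \<in> wom M" "\<delta> (wo_class M f) = wo_class M g"
    by (rule L0_woE)
  then have "\<exists>g. g \<in> wom M \<and> wo_class M g = \<delta> (wo_class M f)" by metis
  then show ?thesis unfolding der_def by (rule someI_ex)
qed

lemma der_alg: "f \<in> alg \<Longrightarrow> der f \<in> alg"
  using der_class[of f] derivation by (auto simp: alg_def wo_derivation_def)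

lemma alg_compose: "f \<in> alg \<Longrightarrow> g \<in> alg \<Longrightarrow> (\<lambda>s. f s o\<^sub>L g s) \<in> alg"
  using subalgebra by (auto simp: alg_def wo_subalgebra_def wom_compose wo_mult_class[symmetric])

lemma Linf_measurable: "a \<in> Linf M \<Longrightarrow> a \<in> borel_measurable M"
  by (simp add: Linf_def)

lemma alg_Linf: "a \<in> Linf M \<Longrightarrow> f \<in> alg \<Longrightarrow> (\<lambda>s. a s *\<^sub>C f s) \<in> alg"
  using Linf_module by (auto simp: alg_def wom_scaleC Linf_measurable wo_scale_class[symmetric])

lemma der_compose:
  assumes f: "f \<in> alg" and g: "g \<in> alg"
  shows "AE s in M. der (\<lambda>s. f s o\<^sub>L g s) s = (der f s o\<^sub>L g s) + (f s o\<^sub>L der g s)"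
proof -
  note fg = alg_compose[OF f g]
  have m: "f \<in> wom M" "g \<in> wom M" "der f \<in> wom M" "der g \<in> wom M"
    using f g der_class alg_wom by blast+
  have "wo_class M (der (\<lambda>s. f s o\<^sub>L g s)) = \<delta> (wo_mult M (wo_class M f) (wo_class M g))"
    using der_class[OF fg] m by (simp add: wo_mult_class)
  also have "\<dots> = wo_add M (wo_mult M (\<delta> (wo_class M f)) (wo_class M g)) (wo_mult M (wo_class M f) (\<delta> (wo_class M g)))"
    using derivation f g by (simp add: wo_derivation_def alg_def)
  also have "\<dots> = wo_class M (\<lambda>s. (der f s o\<^sub>L g s) + (f s o\<^sub>L der g s))"
    using der_class[OF f] der_class[OF g] m
    by (simp add: wo_mult_class wo_add_class wom_compose flip: der_class[OF f, THEN conjunct2] der_class[OF g, THEN conjunct2])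
  finally show ?thesis
    by (subst (asm) wo_class_eq_iff) (use m der_class[OF fg] in \<open>auto intro!: wom_add wom_compose\<close>)
qed

lemma der_Linf:
  assumes a: "a \<in> Linf M" and f: "f \<in> alg"
  shows "AE s in M. der (\<lambda>s. a s *\<^sub>C f s) s = a s *\<^sub>C der f s"
proof -
  note af = alg_Linf[OF a f] and am = Linf_measurable[OF a]
  have m: "f \<in> wom M" "der f \<in> wom M"
    using f der_class alg_wom by blast+
  have "wo_class M (der (\<lambda>s. a s *\<^sub>C f s)) = \<delta> (wo_scale M a (wo_class M f))"
    using der_class[OF af] m am by (simp add: wo_scale_class)
  also have "\<dots> = wo_scale M a (\<delta> (wo_class M f))"
    using Linf_linear a f by (simp add: Linf_linear_on_def alg_def)
  also have "\<dots> = wo_class M (\<lambda>s. a s *\<^sub>C der f s)"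
    using m am by (simp add: wo_scale_class flip: der_class[OF f, THEN conjunct2])
  finally show ?thesis
    by (subst (asm) wo_class_eq_iff) (use m am der_class[OF af] in \<open>auto intro!: wom_scaleC\<close>)
qed

text \<open>
  Linearity over indicator functions makes the derivation local.
\<close>

lemma der_local:
  assumes F: "F \<in> alg" and G: "G \<in> alg" and B: "B \<in> sets M" and eq: "\<And>s. s \<in> B \<Longrightarrow> F s = G s"
  shows "AE s in M. s \<in> B \<longrightarrow> der F s = der G s"
proof -
  have ind: "(indicator B :: 's \<Rightarrow> complex) \<in> Linf M"
    by (rule bounded_in_Linf[where c = 1]) (use B in \<open>auto split: split_indicator\<close>)
  have "(\<lambda>s. indicator B s *\<^sub>C F s) = (\<lambda>s. indicator B s *\<^sub>C G s)"
    using eq by (auto simp: fun_eq_iff split: split_indicator)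
  then have "AE s in M. der (\<lambda>s. indicator B s *\<^sub>C G s) s = indicator B s *\<^sub>C der F s"
    using der_Linf[OF ind F] by simp
  with der_Linf[OF ind G] show ?thesis
    by eventually_elim (auto split: split_indicator_asm)
qed

text \<open>
  Linearity over \<open>L\<^sub>\<infinity>\<close> extends to unbounded scalars \<open>a\<close>, as long as the product stays in the algebra: on each
  set where \<open>a\<close> is bounded by \<open>n\<close>, locality allows to truncate \<open>a\<close>.
\<close>

lemma der_scaleC:
  assumes F: "F \<in> alg" and G: "G \<in> alg" and a: "a \<in> borel_measurable M"
    and eq: "\<And>s. s \<in> space M \<Longrightarrow> G s = a s *\<^sub>C F s"
  shows "AE s in M. der G s = a s *\<^sub>C der F s"
proof -
  note [measurable] = a
  define B where "B n = {s \<in> space M. cmod (a s) \<le> real n}" for n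
  have B: "B n \<in> sets M" for n
    unfolding B_def by measurable
  have *: "AE s in M. s \<in> B n \<longrightarrow> der G s = a s *\<^sub>C der F s" for n
  proof -
    let ?a = "\<lambda>s. indicator (B n) s * a s"
    have "?a \<in> Linf M"
      by (rule bounded_in_Linf[where c = n]) (use B in \<open>auto simp: B_def split: split_indicator\<close>)
    then have "AE s in M. der (\<lambda>s. ?a s *\<^sub>C F s) s = ?a s *\<^sub>C der F s" "(\<lambda>s. ?a s *\<^sub>C F s) \<in> alg"
      using F by (auto intro: der_Linf alg_Linf)
    moreover from this(2) have "AE s in M. s \<in> B n \<longrightarrow> der G s = der (\<lambda>s. ?a s *\<^sub>C F s) s"
      by (rule der_local[OF G _ B]) (simp add: eq B_def)
    ultimately show ?thesis
      by eventually_elim auto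
  qed
  then have "AE s in M. \<forall>n. s \<in> B n \<longrightarrow> der G s = a s *\<^sub>C der F s"
    unfolding AE_all_countable by blast
  then show ?thesis
    using AE_space
  proof eventually_elim
    case (elim s)
    obtain n where "cmod (a s) \<le> real n" using real_arch_simple by blast
    with elim show ?case by (auto simp: B_def)
  qed
qed

lemma uniformly_compact_alg:
  assumes f: "f \<in> wom M" and bdd: "\<And>s. s \<in> space M \<Longrightarrow> norm (f s) \<le> C"
    and p: "\<And>\<epsilon>::real. 0 < \<epsilon> \<Longrightarrow> \<exists>p\<in>finite_rank_idempotents. \<forall>s\<in>space M. norm (f s o\<^sub>L (id_blinfun - p)) \<le> \<epsilon>"
    and E: "E \<in> sets M" "emeasure M E < \<infinity>"
  shows "(\<lambda>s. indicator E s *\<^sub>C f s) \<in> alg"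
proof -
  have ind: "(indicator E :: 's \<Rightarrow> complex) \<in> borel_measurable M"
    using E by simp
  have "wo_scale M (indicator E) (wo_class M f) \<in> A"
  proof (rule uniformly_compact_in[OF _ _ E])
    have "wo_norm M (wo_class M f) \<le> ennreal C"
      by (rule wo_norm_class_le[OF f bdd])
    then show "wo_class M f \<in> Linf_wo M clinear_ops"
      using wo_class_in_L0_wo[OF f] by (auto simp: Linf_wo_def intro: order_le_less_trans)
    fix \<epsilon> :: real
    assume "\<epsilon> > 0"
    then obtain q where q: "q \<in> finite_rank_idempotents" "\<And>s. s \<in> space M \<Longrightarrow> norm (f s o\<^sub>L (id_blinfun - q)) \<le> \<epsilon>"
      using p by blast
    have "id_blinfun - q \<in> clinear_ops"
      using q(1) by (intro clinear_ops_diff) (auto simp: finite_rank_idempotents_def finite_rank_ops_def clinear_ops_def)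
    then have m: "(\<lambda>s. id_blinfun - q) \<in> wom M" by (rule wom_const)
    then have "wo_norm M (wo_mult M (wo_class M f) (wo_const M (id_blinfun - q))) \<le> ennreal \<epsilon>"
      unfolding wo_const_def wo_mult_class[OF f m] by (intro wo_norm_class_le wom_compose f q(2))
    with q(1) show "\<exists>p\<in>finite_rank_idempotents. wo_norm M (wo_mult M (wo_class M f) (wo_const M (id_blinfun - p))) \<le> ennreal \<epsilon>"
      by blast
  qed
  then show ?thesis
    using f ind by (simp add: alg_def wo_scale_class wom_scaleC)
qed

text \<open>
  The idempotent is \<open>e \<otimes> \<psi>\<close> with \<open>\<psi> e = 1\<close> (or \<open>0\<close> if \<open>\<psi> = 0\<close>): its complement maps into the kernel of \<open>\<psi>\<close>, so
  no approximation is necessary.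
\<close>

lemma rank_one_alg:
  assumes y: "y \<in> weakly_measurable M" "\<And>s. s \<in> space M \<Longrightarrow> norm (y s) \<le> C"
    and \<psi>: "\<psi> \<in> clinear_ops" and E: "E \<in> sets M" "emeasure M E < \<infinity>"
  shows "(\<lambda>s. indicator E s *\<^sub>C rank_one (y s) \<psi>) \<in> alg"
proof (rule uniformly_compact_alg[OF _ _ _ E])
  show "(\<lambda>s. rank_one (y s) \<psi>) \<in> wom M"
    using y \<psi> by (auto simp: wo_measurable_iff rank_one_clinear intro!: weakly_measurable_scaleC)
  show "norm (rank_one (y s) \<psi>) \<le> C * norm \<psi>" if "s \<in> space M" for s
    using norm_rank_one_le[of "y s" \<psi>] y(2)[OF that] mult_right_mono[of "norm (y s)" C "norm \<psi>"] by simp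
  fix \<epsilon> :: real
  assume \<epsilon>: "\<epsilon> > 0"
  have "\<exists>p\<in>finite_rank_idempotents. \<forall>x. \<psi> (x - blinfun_apply p x) = 0"
  proof (cases "\<psi> = 0")
    case True
    have "finite_expansion 0 (\<lambda>_. 0) (\<lambda>_. \<psi>) \<in> finite_rank_idempotents"
      by (rule finite_expansion_idempotent) (simp add: biorthogonal_def)
    with True show ?thesis by auto
  next
    case False
    then obtain z where z: "\<psi> z \<noteq> 0"
      using blinfun_eqI[of \<psi> 0] by auto
    define e where "e = inverse (\<psi> z) *\<^sub>C z"
    have e: "\<psi> e = 1"
      using z by (simp add: e_def functional_scaleC[OF \<psi>])
    have "finite_expansion 1 (\<lambda>_. e) (\<lambda>_. \<psi>) \<in> finite_rank_idempotents"
      by (rule finite_expansion_idempotent) (simp add: biorthogonal_def \<psi> e)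
    moreover have "\<psi> (x - finite_expansion 1 (\<lambda>_. e) (\<lambda>_. \<psi>) x) = 0" for x
      by (simp add: finite_expansion_apply blinfun.diff_right functional_scaleC[OF \<psi>] e)
    ultimately show ?thesis by blast
  qed
  then obtain p where p: "p \<in> finite_rank_idempotents" "\<And>x. \<psi> (x - blinfun_apply p x) = 0" by blast
  have "rank_one (y s) \<psi> o\<^sub>L (id_blinfun - p) = 0" for s
    by (rule blinfun_eqI) (simp add: blinfun.diff_left p(2))
  with p(1) \<epsilon> show "\<exists>p\<in>finite_rank_idempotents. \<forall>s\<in>space M. norm (rank_one (y s) \<psi> o\<^sub>L (id_blinfun - p)) \<le> \<epsilon>"
    by (intro bexI[of _ p]) auto
qed

lemma series_operator_alg:
  assumes biorth: "\<And>n. biorthogonal n u \<phi>"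
    and y: "\<And>n. y n \<in> weakly_measurable M" and bound: "\<And>n s. norm (y n s) * norm (\<phi> n) \<le> (1 / 2) ^ n"
    and E: "E \<in> sets M" "emeasure M E < \<infinity>"
  shows "(\<lambda>s. indicator E s *\<^sub>C series_operator (\<lambda>n. y n s) \<phi>) \<in> alg"
proof (rule uniformly_compact_alg[OF _ _ _ E])
  have \<phi>: "\<phi> n \<in> clinear_ops" for n
    using biorth[of "Suc n"] by (simp add: biorthogonal_def)
  have "(\<lambda>s. blinfun_apply (series_operator (\<lambda>n. y n s) \<phi>) x) \<in> weakly_measurable M" for x
  proof (rule weakly_measurable_LIMSEQ)
    show "(\<lambda>s. \<Sum>i<n. \<phi> i x *\<^sub>C y i s) \<in> weakly_measurable M" for n
      by (intro weakly_measurable_sum weakly_measurable_scaleC y) simp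
    show "(\<lambda>n. \<Sum>i<n. \<phi> i x *\<^sub>C y i s) \<longlonglongrightarrow> series_operator (\<lambda>n. y n s) \<phi> x" for s
      using series_operator_sums[OF bound, of x] by (simp add: sums_def)
  qed
  then show "(\<lambda>s. series_operator (\<lambda>n. y n s) \<phi>) \<in> wom M"
    by (simp add: wo_measurable_iff series_operator_clinear[OF bound \<phi>])
  show "norm (series_operator (\<lambda>n. y n s) \<phi>) \<le> 2" for s
    by (rule norm_series_operator_le[OF bound])
  fix \<epsilon> :: real
  assume "0 < \<epsilon>"
  then obtain n where "(1 / 2) ^ n < \<epsilon> / 2"
    using real_arch_pow_inv[of "\<epsilon> / 2" "1 / 2"] by auto
  then have "2 * (1 / 2) ^ n \<le> \<epsilon>" by simp
  with norm_series_operator_remainder[OF bound biorth]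
  have "norm (series_operator (\<lambda>n. y n s) \<phi> o\<^sub>L (id_blinfun - finite_expansion n u \<phi>)) \<le> \<epsilon>" for s
    by (rule order_trans)
  with finite_expansion_idempotent[OF biorth]
  show "\<exists>p\<in>finite_rank_idempotents. \<forall>s\<in>space M. norm (series_operator (\<lambda>n. y n s) \<phi> o\<^sub>L (id_blinfun - p)) \<le> \<epsilon>"
    by blast
qed

end

section \<open>The implementing operators on a set of finite measure\<close>

text \<open>
  A Lipschitz function on the dense sequence extends continuously to the whole space. Linearity of the
  extension comes from the identity \<open>eq\<close>: its other terms are linear and continuous, so it extends along with
  \<open>g\<close>, and it determines the extension, because \<open>\<Psi>\<close> separates points.
\<close>

lemma (in norming_sequences) extend_to_clinear:
  assumes lip: "\<And>i j. norm (g i - g j) \<le> K * norm (D i - D j)"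
    and q: "\<And>k. q k \<in> clinear_ops" and x0: "x0 \<noteq> 0"
    and eq: "\<And>i k. \<Psi> k (D i) *\<^sub>C c = blinfun_apply (q k) (D i) + \<Psi> k (g i) *\<^sub>C x0"
  shows "\<exists>w. w \<in> clinear_ops \<and> (\<forall>i. blinfun_apply w (D i) = g i)"
proof -
  define f where "f x = g (SOME i. D i = x)" for x
  have f: "f (D i) = g i" for i
  proof -
    have "D (SOME j. D j = D i) = D i" by (rule someI) simp
    then show ?thesis using lip[of "SOME j. D j = D i" i] by (simp add: f_def)
  qed
  have "norm (g i - g j) \<le> \<bar>K\<bar> * norm (D i - D j)" for i j
    by (rule order_trans[OF lip mult_right_mono]) auto
  then have "\<bar>K\<bar>-lipschitz_on (range D) f"
    by (auto simp: lipschitz_on_def dist_norm f)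
  then obtain w where w: "\<bar>K\<bar>-lipschitz_on UNIV w" "\<And>i. w (D i) = g i"
    using lipschitz_extend_closure[of "\<bar>K\<bar>" "range D" f] f by (auto simp: dense)
  have cont: "continuous_on UNIV w"
    using w(1) by (rule lipschitz_on_continuous_on)
  have id: "\<Psi> k z *\<^sub>C c = blinfun_apply (q k) z + \<Psi> k (w z) *\<^sub>C x0" for k z
  proof (rule eq_on_dense[of "\<lambda>z. \<Psi> k z *\<^sub>C c" "\<lambda>z. blinfun_apply (q k) z + \<Psi> k (w z) *\<^sub>C x0"])
    show "continuous_on UNIV (\<lambda>z. \<Psi> k z *\<^sub>C c)"
      by (intro linear_continuous_on bounded_linear_compose[OF bounded_linear_scaleC_left] blinfun.bounded_linear_right)
    have "continuous_on UNIV (\<lambda>z. \<Psi> k (w z) *\<^sub>C x0)"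
      by (rule continuous_on_compose2[OF linear_continuous_on cont, of _ UNIV])
        (auto intro: bounded_linear_compose[OF bounded_linear_scaleC_left] blinfun.bounded_linear_right)
    then show "continuous_on UNIV (\<lambda>z. blinfun_apply (q k) z + \<Psi> k (w z) *\<^sub>C x0)"
      by (rule continuous_on_add[OF linear_continuous_on[OF blinfun.bounded_linear_right]])
    show "\<Psi> k (D i) *\<^sub>C c = blinfun_apply (q k) (D i) + \<Psi> k (w (D i)) *\<^sub>C x0" for i
      using eq w(2) by simp
  qed
  have cancel: "a = b" if "a *\<^sub>C x0 = b *\<^sub>C x0" for a b
    using that x0 by (simp add: complex_vector.scale_cancel_right)
  have add: "w (y + z) = w y + w z" for y z
  proof (rule eq_if_\<Psi>_eq, rule cancel)
    fix k
    show "\<Psi> k (w (y + z)) *\<^sub>C x0 = \<Psi> k (w y + w z) *\<^sub>C x0"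
      using id[of k y] id[of k z] id[of k "y + z"]
      by (simp add: blinfun.add_right scaleC_add_left)
  qed
  have scale: "w (a *\<^sub>C z) = a *\<^sub>C w z" for a z
  proof (rule eq_if_\<Psi>_eq, rule cancel)
    fix k
    have "blinfun_apply (q k) (a *\<^sub>C z) + \<Psi> k (w (a *\<^sub>C z)) *\<^sub>C x0 = \<Psi> k (a *\<^sub>C z) *\<^sub>C c"
      using id by simp
    also have "\<dots> = a *\<^sub>C \<Psi> k z *\<^sub>C c"
      by (simp add: functional_scaleC \<Psi>_clinear)
    also have "\<dots> = blinfun_apply (q k) (a *\<^sub>C z) + \<Psi> k (a *\<^sub>C w z) *\<^sub>C x0"
      unfolding id by (simp add: functional_scaleC \<Psi>_clinear clinear_opsD[OF q] scaleC_add_right)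
    finally show "\<Psi> k (w (a *\<^sub>C z)) *\<^sub>C x0 = \<Psi> k (a *\<^sub>C w z) *\<^sub>C x0" by simp
  qed
  have "w 0 = 0" using add[of 0 0] by simp
  then have "norm (w z) \<le> norm z * \<bar>K\<bar>" for z
    using lipschitz_onD[OF w(1), of z 0] by (simp add: dist_norm mult.commute)
  then have "bounded_linear w"
    using add scale[of "complex_of_real _"] by (intro bounded_linear_intro[where K = "\<bar>K\<bar>"]) (auto simp: scaleC_of_real)
  then have ap: "blinfun_apply (Blinfun w) = w" by (rule bounded_linear_Blinfun_apply)
  show ?thesis
    by (rule exI[of _ "Blinfun w"]) (simp add: clinear_ops_def ap scale w(2))
qed

locale admissible_derivation_on = admissible_derivation D \<Psi> M A \<delta>
  for D :: "nat \<Rightarrow> 'x::complex_banach" and \<Psi> :: "nat \<Rightarrow> 'x \<Rightarrow>\<^sub>L complex" and M :: "'s measure" and A \<delta> +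
  fixes x0 :: 'x and \<phi>0 :: "'x \<Rightarrow>\<^sub>L complex" and E :: "'s set"
  assumes \<phi>0: "\<phi>0 \<in> clinear_ops" "\<phi>0 x0 = 1" and E: "E \<in> sets M" "emeasure M E < \<infinity>"
begin

definition cut_rank_one :: "'x \<Rightarrow> ('x \<Rightarrow>\<^sub>L complex) \<Rightarrow> 's \<Rightarrow> 'x \<Rightarrow>\<^sub>L 'x"
  where "cut_rank_one x \<psi> s = indicator E s *\<^sub>C rank_one x \<psi>"

text \<open>
  The value at \<open>x\<close> that the implementing operator \<open>w s\<close> should have. For fixed \<open>s\<close> this is meaningful
  for countably many \<open>x\<close> only, since \<open>der\<close> picks representatives separately for each \<open>x\<close>.
\<close>

definition candidate :: "'x \<Rightarrow> 's \<Rightarrow> 'x"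
  where "candidate x s = der (cut_rank_one x \<phi>0) s x0"

lemma x0_nonzero: "x0 \<noteq> 0"
  using \<phi>0(2) by auto

lemma cut_rank_one_alg: "\<psi> \<in> clinear_ops \<Longrightarrow> cut_rank_one x \<psi> \<in> alg"
  unfolding cut_rank_one_def by (rule rank_one_alg[OF weakly_measurable_const order_refl _ E])

lemma wom_apply: "f \<in> wom M \<Longrightarrow> (\<lambda>s. blinfun_apply (f s) x) \<in> weakly_measurable M"
  by (simp add: wo_measurable_iff)

lemma candidate_measurable: "candidate x \<in> weakly_measurable M"
  unfolding candidate_def by (intro wom_apply alg_wom der_alg cut_rank_one_alg \<phi>0)

text \<open>
  Product rule for \<open>Q f P\<close> with \<open>P = \<chi>\<^sub>E (x \<otimes> \<phi>0)\<close> and \<open>Q = \<chi>\<^sub>E (x0 \<otimes> \<psi>)\<close>. The product is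
  \<open>\<psi>(f x) \<chi>\<^sub>E (x0 \<otimes> \<phi>0)\<close>, and its image under the derivation is known because the scalar \<open>\<psi>(f x)\<close>, although
  unbounded in general, can be pulled out.
\<close>

lemma sandwich:
  assumes f: "f \<in> alg" and \<psi>: "\<psi> \<in> clinear_ops"
  shows "AE s in M. s \<in> E \<longrightarrow>
    \<psi> (f s x) *\<^sub>C candidate x0 s = der (cut_rank_one x0 \<psi>) s (f s x) + \<psi> (der f s x) *\<^sub>C x0 + \<psi> (f s (candidate x s)) *\<^sub>C x0"
proof -
  let ?P = "cut_rank_one x \<phi>0" and ?Q = "cut_rank_one x0 \<psi>"
  note P = cut_rank_one_alg[OF \<phi>0(1), of x] and Q = cut_rank_one_alg[OF \<psi>, of x0]
  note fP = alg_compose[OF f P] and QfP = alg_compose[OF Q alg_compose[OF f P]]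
  have "(\<lambda>s. \<psi> (f s x)) \<in> borel_measurable M"
    by (intro weakly_measurableD wom_apply alg_wom f \<psi>)
  moreover have "?Q s o\<^sub>L (f s o\<^sub>L ?P s) = \<psi> (f s x) *\<^sub>C cut_rank_one x0 \<phi>0 s" if "s \<in> space M" for s
    by (rule blinfun_eqI)
      (simp add: cut_rank_one_def blinfun_apply_scaleC clinear_opsD[OF alg_clinear[OF f that]] functional_scaleC[OF \<psi>]
        scaleC_scaleC mult.commute split: split_indicator)
  ultimately have "AE s in M. der (\<lambda>s. ?Q s o\<^sub>L (f s o\<^sub>L ?P s)) s = \<psi> (f s x) *\<^sub>C der (cut_rank_one x0 \<phi>0) s"
    by (rule der_scaleC[OF cut_rank_one_alg[OF \<phi>0(1)] QfP])
  with der_compose[OF Q fP] der_compose[OF f P] show ?thesis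
  proof eventually_elim
    case (elim s)
    show ?case
    proof
      assume s: "s \<in> E"
      have "\<psi> (f s x) *\<^sub>C candidate x0 s = (\<psi> (f s x) *\<^sub>C der (cut_rank_one x0 \<phi>0) s) x0"
        by (simp add: candidate_def blinfun_apply_scaleC)
      also have "\<dots> = (der ?Q s o\<^sub>L (f s o\<^sub>L ?P s)) x0 + (?Q s o\<^sub>L ((der f s o\<^sub>L ?P s) + (f s o\<^sub>L der ?P s))) x0"
        using elim by (simp add: blinfun.add_left)
      also have "\<dots> = der ?Q s (f s x) + \<psi> (der f s x) *\<^sub>C x0 + \<psi> (f s (candidate x s)) *\<^sub>C x0"
        using s \<phi>0(2) by (simp add: cut_rank_one_def candidate_def blinfun_apply_scaleC blinfun.add_left blinfun.add_right scaleC_add_left add.assoc)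
      finally show "\<psi> (f s x) *\<^sub>C candidate x0 s = der ?Q s (f s x) + \<psi> (der f s x) *\<^sub>C x0 + \<psi> (f s (candidate x s)) *\<^sub>C x0" .
    qed
  qed
qed

text \<open>
  The relation that the product rule for \<open>(x0 \<otimes> \<Psi> k) (x \<otimes> \<phi>0)\<close> imposes on \<open>y = w x\<close>. It
  depends linearly on \<open>(x, y)\<close> and determines \<open>y\<close>, hence it carries all linearity properties of the candidate.
\<close>

definition consistent :: "'s \<Rightarrow> 'x \<Rightarrow> 'x \<Rightarrow> bool"
  where "consistent s x y \<longleftrightarrow> (\<forall>k. \<Psi> k x *\<^sub>C candidate x0 s = der (cut_rank_one x0 (\<Psi> k)) s x + \<Psi> k y *\<^sub>C x0)"

lemma consistent_candidate: "AE s in M. s \<in> E \<longrightarrow> consistent s x (candidate x s)"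
proof -
  have "AE s in M. s \<in> E \<longrightarrow> \<Psi> k x *\<^sub>C candidate x0 s = der (cut_rank_one x0 (\<Psi> k)) s x + \<Psi> k (candidate x s) *\<^sub>C x0" for k
  proof -
    let ?P = "cut_rank_one x \<phi>0" and ?Q = "cut_rank_one x0 (\<Psi> k)"
    note P = cut_rank_one_alg[OF \<phi>0(1), of x] and Q = cut_rank_one_alg[OF \<Psi>_clinear, of x0 k]
    have "?Q s o\<^sub>L ?P s = \<Psi> k x *\<^sub>C cut_rank_one x0 \<phi>0 s" for s
      by (rule blinfun_eqI)
        (simp add: cut_rank_one_def blinfun_apply_scaleC functional_scaleC[OF \<Psi>_clinear]
          scaleC_scaleC mult.commute split: split_indicator)
    then have "AE s in M. der (\<lambda>s. ?Q s o\<^sub>L ?P s) s = \<Psi> k x *\<^sub>C der (cut_rank_one x0 \<phi>0) s"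
      by (intro der_scaleC[OF cut_rank_one_alg[OF \<phi>0(1)] alg_compose[OF Q P]]) auto
    with der_compose[OF Q P] show ?thesis
    proof eventually_elim
      case (elim s)
      show ?case
      proof
        assume s: "s \<in> E"
        have "\<Psi> k x *\<^sub>C candidate x0 s = (\<Psi> k x *\<^sub>C der (cut_rank_one x0 \<phi>0) s) x0"
          by (simp add: candidate_def blinfun_apply_scaleC)
        also have "\<dots> = (der ?Q s o\<^sub>L ?P s) x0 + (?Q s o\<^sub>L der ?P s) x0"
          using elim by (simp add: blinfun.add_left)
        also have "\<dots> = der ?Q s x + \<Psi> k (candidate x s) *\<^sub>C x0"
          using s \<phi>0(2) by (simp add: cut_rank_one_def candidate_def blinfun_apply_scaleC)
        finally show "\<Psi> k x *\<^sub>C candidate x0 s = der ?Q s x + \<Psi> k (candidate x s) *\<^sub>C x0" .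
      qed
    qed
  qed
  then have "AE s in M. \<forall>k. s \<in> E \<longrightarrow> \<Psi> k x *\<^sub>C candidate x0 s = der (cut_rank_one x0 (\<Psi> k)) s x + \<Psi> k (candidate x s) *\<^sub>C x0"
    unfolding AE_all_countable by blast
  then show ?thesis
    unfolding consistent_def by eventually_elim blast
qed

lemma consistent_candidate_sequence: "AE s in M. s \<in> E \<longrightarrow> (\<forall>i. consistent s (z i) (candidate (z i) s))"
  for z :: "nat \<Rightarrow> 'x"
proof -
  have "AE s in M. \<forall>i. s \<in> E \<longrightarrow> consistent s (z i) (candidate (z i) s)"
    unfolding AE_all_countable using consistent_candidate by blast
  then show ?thesis by eventually_elim blast
qed

lemma der_cut_clinear: "s \<in> space M \<Longrightarrow> der (cut_rank_one x0 (\<Psi> k)) s \<in> clinear_ops"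
  by (intro alg_clinear der_alg cut_rank_one_alg \<Psi>_clinear)

lemma consistent_unique:
  assumes "consistent s x y" "consistent s x y'"
  shows "y = y'"
proof (rule eq_if_\<Psi>_eq)
  fix k
  have "\<Psi> k y *\<^sub>C x0 = \<Psi> k y' *\<^sub>C x0"
    using assms unfolding consistent_def by (metis add_left_cancel)
  then show "\<Psi> k y = \<Psi> k y'"
    using x0_nonzero by (simp add: complex_vector.scale_cancel_right)
qed

lemma consistent_zero: "consistent s 0 0"
  by (simp add: consistent_def)

lemma consistent_diff: "consistent s x y \<Longrightarrow> consistent s x' y' \<Longrightarrow> consistent s (x - x') (y - y')"
  by (simp add: consistent_def blinfun.diff_right complex_vector.scale_left_diff_distrib)

lemma consistent_add: "consistent s x y \<Longrightarrow> consistent s x' y' \<Longrightarrow> consistent s (x + x') (y + y')"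
  by (simp add: consistent_def blinfun.add_right scaleC_add_left)

lemma consistent_scaleC:
  assumes "s \<in> space M" "consistent s x y"
  shows "consistent s (a *\<^sub>C x) (a *\<^sub>C y)"
  unfolding consistent_def
proof
  fix k
  have "\<Psi> k (a *\<^sub>C x) *\<^sub>C candidate x0 s = a *\<^sub>C \<Psi> k x *\<^sub>C candidate x0 s"
    by (simp add: functional_scaleC \<Psi>_clinear)
  also have "\<dots> = a *\<^sub>C (der (cut_rank_one x0 (\<Psi> k)) s x + \<Psi> k y *\<^sub>C x0)"
    using assms(2) by (simp add: consistent_def)
  finally show "\<Psi> k (a *\<^sub>C x) *\<^sub>C candidate x0 s = der (cut_rank_one x0 (\<Psi> k)) s (a *\<^sub>C x) + \<Psi> k (a *\<^sub>C y) *\<^sub>C x0"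
    by (simp add: functional_scaleC \<Psi>_clinear clinear_opsD[OF der_cut_clinear[OF assms(1)]] scaleC_add_right)
qed

lemma consistent_sum:
  fixes n :: nat
  assumes "s \<in> space M" "\<And>i. i < n \<Longrightarrow> consistent s (x i) (y i)"
  shows "consistent s (\<Sum>i<n. a i *\<^sub>C x i) (\<Sum>i<n. a i *\<^sub>C y i)"
  using assms(2) by (induction n) (auto intro: consistent_zero consistent_add consistent_scaleC assms(1))

text \<open>
  The defining formula of the candidate persists if the vector varies with \<open>s\<close> within a countable set, by
  locality on the sets where the index \<open>j\<close> is constant.
\<close>

lemma der_countably_valued:
  fixes z :: "nat \<Rightarrow> 'x"
  assumes j: "j \<in> measurable M (count_space UNIV)" and G: "(\<lambda>s. indicator E s *\<^sub>C rank_one (z (j s)) \<phi>0) \<in> alg"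
  shows "AE s in M. s \<in> E \<longrightarrow> der (\<lambda>s. indicator E s *\<^sub>C rank_one (z (j s)) \<phi>0) s x0 = candidate (z (j s)) s"
proof -
  note [measurable] = j
  have "AE s in M. s \<in> {s \<in> space M. j s = k} \<longrightarrow>
    der (\<lambda>s. indicator E s *\<^sub>C rank_one (z (j s)) \<phi>0) s = der (cut_rank_one (z k) \<phi>0) s" for k
    by (rule der_local[OF G cut_rank_one_alg[OF \<phi>0(1)]]) (auto simp: cut_rank_one_def)
  then have "AE s in M. \<forall>k. s \<in> {s \<in> space M. j s = k} \<longrightarrow>
    der (\<lambda>s. indicator E s *\<^sub>C rank_one (z (j s)) \<phi>0) s = der (cut_rank_one (z k) \<phi>0) s"
    unfolding AE_all_countable by blast
  then show ?thesis
    using AE_space by eventually_elim (simp add: candidate_def)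
qed

text \<open>
  Every vector is a combination of \<open>u 0, \<dots>, u (n - 1)\<close> with coefficients bounded by its norm, and the
  candidate respects such combinations.
\<close>

lemma candidate_bounded_finite:
  fixes z u :: "nat \<Rightarrow> 'x"
  assumes b: "biorthogonal n u \<phi>" and id: "finite_expansion n u \<phi> = id_blinfun"
  shows "AE s in M. s \<in> E \<longrightarrow> (\<exists>K. \<forall>m. norm (candidate (z m) s) \<le> K * norm (z m))"
  using consistent_candidate_sequence[of z] consistent_candidate_sequence[of u] AE_space
proof eventually_elim
  case (elim s)
  show ?case
  proof
    assume s: "s \<in> E"
    have "norm (candidate (z m) s) \<le> (\<Sum>i<n. norm (\<phi> i) * norm (candidate (u i) s)) * norm (z m)" for m
    proof -
      have zm: "z m = (\<Sum>i<n. \<phi> i (z m) *\<^sub>C u i)"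
        using finite_expansion_apply[of n u \<phi> "z m"] id by simp
      have "candidate (z m) s = (\<Sum>i<n. \<phi> i (z m) *\<^sub>C candidate (u i) s)"
      proof (rule consistent_unique)
        show "consistent s (z m) (candidate (z m) s)" using elim s by blast
        show "consistent s (z m) (\<Sum>i<n. \<phi> i (z m) *\<^sub>C candidate (u i) s)"
          by (subst zm, rule consistent_sum) (use elim s in auto)
      qed
      also have "norm \<dots> \<le> (\<Sum>i<n. norm (\<phi> i (z m) *\<^sub>C candidate (u i) s))" by (rule norm_sum)
      also have "\<dots> \<le> (\<Sum>i<n. norm (\<phi> i) * norm (candidate (u i) s) * norm (z m))"
      proof (rule sum_mono)
        fix i
        show "norm (\<phi> i (z m) *\<^sub>C candidate (u i) s) \<le> norm (\<phi> i) * norm (candidate (u i) s) * norm (z m)"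
          using mult_right_mono[OF norm_blinfun[of "\<phi> i" "z m"], of "norm (candidate (u i) s)"]
          by (simp add: norm_scaleC mult_ac)
      qed
      finally show ?thesis by (simp add: sum_distrib_right)
    qed
    then show "\<exists>K. \<forall>m. norm (candidate (z m) s) \<le> K * norm (z m)" by blast
  qed
qed

text \<open>
  The gliding hump. For each \<open>n\<close> let \<open>j n s\<close> point to the first \<open>z m\<close> at which the candidate exceeds the threshold
  \<open>n C\<^sub>n(s) / \<epsilon>\<^sub>n\<close> times the norm, if there is one, and let \<open>y\<^sub>n(s)\<close> be that vector, rescaled to norm \<open>\<epsilon>\<^sub>n\<close>. The single
  function \<open>f = \<chi>\<^sub>E \<Sum>\<^sub>n y\<^sub>n \<otimes> \<phi>\<^sub>n\<close> bounds the candidate at \<open>y\<^sub>n(s)\<close> by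
  \<open>(\<parallel>der f s\<parallel> + 2) C\<^sub>n(s)\<close> for all \<open>n\<close>. Once \<open>n\<close> is at least \<open>\<parallel>der f s\<parallel> + 2\<close>, the threshold cannot have been
  exceeded, and it is the bound that is claimed.
\<close>

lemma candidate_bounded_infinite:
  fixes z u :: "nat \<Rightarrow> 'x"
  assumes b: "\<And>n. biorthogonal n u \<phi>"
  shows "AE s in M. s \<in> E \<longrightarrow> (\<exists>K. \<forall>m. norm (candidate (z m) s) \<le> K * norm (z m))"
proof -
  \<comment> \<open>\<open>\<epsilon> n\<close> makes the series for \<open>f\<close> converge geometrically; \<open>C n s\<close> dominates the coefficients
    in the product rule for \<open>f (u n \<otimes> \<phi>0)\<close>.\<close>
  define \<epsilon> where "\<epsilon> n = (1 / 2) ^ n / (1 + norm (\<phi> n))" for n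
  define C where "C n s = norm (u n) + norm (candidate (u n) s) + 1" for n s
  define large where "large n s m \<longleftrightarrow> norm (candidate (z m) s) > real n * C n s / \<epsilon> n * norm (z m)" for n s m
  \<comment> \<open>Index \<open>0\<close> stands for no large candidate value; then \<open>y n 0 = 0\<close>.\<close>
  define j where "j n s = (if \<exists>m. large n s m then Suc (LEAST m. large n s m) else 0)" for n s
  define y where "y n i = (case i of 0 \<Rightarrow> 0 | Suc m \<Rightarrow> complex_of_real (\<epsilon> n / norm (z m)) *\<^sub>C z m)" for n i
  have pos: "1 + norm (\<phi> n) > 0" for n
    by (simp add: add_pos_nonneg)
  have \<epsilon>: "\<epsilon> n > 0" for n
    using pos by (simp add: \<epsilon>_def)
  have [measurable]: "(\<lambda>s. norm (candidate x s)) \<in> borel_measurable M" for x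
    by (rule borel_measurable_norm_weakly[OF candidate_measurable])
  have j: "j n \<in> measurable M (count_space UNIV)" for n
    unfolding j_def large_def C_def by measurable
  have y_norm: "norm (y n i) \<le> \<epsilon> n" for n i
    using \<epsilon>[of n] by (cases i) (auto simp: y_def norm_scaleC norm_divide)
  have y_meas: "(\<lambda>s. y n (j n s)) \<in> weakly_measurable M" for n
    by (rule weakly_measurable_countable_index[OF weakly_measurable_const j])
  have y_bound: "norm (y n i) * norm (\<phi> n) \<le> (1 / 2) ^ n" for n i
  proof -
    have "norm (y n i) * norm (\<phi> n) \<le> \<epsilon> n * (1 + norm (\<phi> n))"
      using y_norm[of n i] \<epsilon>[of n] by (intro mult_mono) auto
    also have "\<dots> = (1 / 2) ^ n"
      using pos[of n] by (simp add: \<epsilon>_def)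
    finally show ?thesis .
  qed
  define f where "f s = indicator E s *\<^sub>C series_operator (\<lambda>n. y n (j n s)) \<phi>" for s
  have f: "f \<in> alg"
    unfolding f_def by (rule series_operator_alg[OF b y_meas y_bound E])
  have f_norm: "norm (f s) \<le> 2" for s
    using norm_series_operator_le[OF y_bound, of "\<lambda>n. j n s"] by (auto simp: f_def split: split_indicator)
  have est: "AE s in M. s \<in> E \<longrightarrow> norm (candidate (y n (j n s)) s) \<le> (norm (der f s) + 2) * C n s" for n
  proof -
    let ?P = "cut_rank_one (u n) \<phi>0"
    note P = cut_rank_one_alg[OF \<phi>0(1), of "u n"]
    have fP: "(\<lambda>s. f s o\<^sub>L ?P s) = (\<lambda>s. indicator E s *\<^sub>C rank_one (y n (j n s)) \<phi>0)"
    proof (rule ext, rule blinfun_eqI)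
      fix s x
      have cl: "series_operator (\<lambda>n. y n (j n s)) \<phi> \<in> clinear_ops"
        using b[of "Suc _"] by (intro series_operator_clinear y_bound) (auto simp: biorthogonal_def)
      show "(f s o\<^sub>L ?P s) x = (indicator E s *\<^sub>C rank_one (y n (j n s)) \<phi>0) x"
        by (auto simp: f_def cut_rank_one_def blinfun_apply_scaleC clinear_opsD[OF cl] series_operator_basis[OF y_bound b]
          split: split_indicator)
    qed
    have "AE s in M. s \<in> E \<longrightarrow> der (\<lambda>s. f s o\<^sub>L ?P s) s x0 = candidate (y n (j n s)) s"
      unfolding fP by (rule der_countably_valued[OF j]) (use alg_compose[OF f P] fP in simp)
    with der_compose[OF f P] show ?thesis
    proof eventually_elim
      case (elim s)
      show ?case
      proof
        assume s: "s \<in> E"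
        have "candidate (y n (j n s)) s = der f s (u n) + f s (candidate (u n) s)"
          using elim s \<phi>0(2) by (simp add: blinfun.add_left cut_rank_one_def blinfun_apply_scaleC candidate_def)
        also have "norm \<dots> \<le> norm (der f s (u n)) + norm (f s (candidate (u n) s))"
          by (rule norm_triangle_ineq)
        also have "norm (der f s (u n)) \<le> norm (der f s) * norm (u n)"
          by (rule norm_blinfun)
        also have "norm (f s (candidate (u n) s)) \<le> 2 * norm (candidate (u n) s)"
          using norm_blinfun[of "f s" "candidate (u n) s"] mult_right_mono[OF f_norm[of s], of "norm (candidate (u n) s)"] by simp
        also have "norm (der f s) * norm (u n) + 2 * norm (candidate (u n) s) \<le> (norm (der f s) + 2) * C n s"
          by (simp add: C_def algebra_simps)
        finally show "norm (candidate (y n (j n s)) s) \<le> (norm (der f s) + 2) * C n s" by simp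
      qed
    qed
  qed
  then have "AE s in M. \<forall>n. s \<in> E \<longrightarrow> norm (candidate (y n (j n s)) s) \<le> (norm (der f s) + 2) * C n s"
    unfolding AE_all_countable by blast
  moreover have "AE s in M. \<forall>n. s \<in> E \<longrightarrow> (\<forall>m. consistent s (y n m) (candidate (y n m) s))"
    unfolding AE_all_countable using consistent_candidate_sequence by blast
  ultimately show ?thesis
    using consistent_candidate_sequence[of z] AE_space
  proof eventually_elim
    case (elim s)
    show ?case
    proof
      assume s: "s \<in> E"
      obtain n where n: "norm (der f s) + 2 \<le> real n" using real_arch_simple by blast
      have "\<not> large n s m" for m
      proof
        \<comment> \<open>At the first such index the rescaled vector has a candidate value above \<open>n C\<^sub>n(s)\<close>.\<close>
        assume "large n s m"
        then obtain m where m: "large n s m" "j n s = Suc m"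
          unfolding j_def by (metis LeastI)
        have c_zm: "consistent s (z m) (candidate (z m) s)" using elim s by blast
        have z: "z m \<noteq> 0"
        proof
          assume "z m = 0"
          with c_zm have "candidate (z m) s = 0" using consistent_unique consistent_zero by metis
          with m(1) \<open>z m = 0\<close> show False by (simp add: large_def)
        qed
        have "candidate (y n (j n s)) s = complex_of_real (\<epsilon> n / norm (z m)) *\<^sub>C candidate (z m) s"
        proof (rule consistent_unique)
          show "consistent s (y n (j n s)) (candidate (y n (j n s)) s)" using elim s by blast
          show "consistent s (y n (j n s)) (complex_of_real (\<epsilon> n / norm (z m)) *\<^sub>C candidate (z m) s)"
            using consistent_scaleC[OF _ c_zm] elim m(2) by (simp add: y_def)
        qed
        then have "norm (candidate (y n (j n s)) s) = \<epsilon> n / norm (z m) * norm (candidate (z m) s)"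
          using \<epsilon>[of n] by (simp add: norm_scaleC norm_divide)
        moreover have "\<epsilon> n / norm (z m) * norm (candidate (z m) s) > \<epsilon> n / norm (z m) * (real n * C n s / \<epsilon> n * norm (z m))"
          using m(1) \<epsilon>[of n] z by (intro mult_strict_left_mono) (auto simp: large_def)
        moreover have "\<epsilon> n / norm (z m) * (real n * C n s / \<epsilon> n * norm (z m)) = real n * C n s"
          using \<epsilon>[of n] z by simp
        moreover have "norm (candidate (y n (j n s)) s) \<le> real n * C n s"
        proof -
          have "0 \<le> C n s" by (simp add: C_def)
          with n have "(norm (der f s) + 2) * C n s \<le> real n * C n s" by (rule mult_right_mono)
          with elim s show ?thesis by (meson order_trans)
        qed
        ultimately show False by simp
      qed
      then have "norm (candidate (z m) s) \<le> real n * C n s / \<epsilon> n * norm (z m)" for m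
        unfolding large_def by (meson not_le)
      then show "\<exists>K. \<forall>m. norm (candidate (z m) s) \<le> K * norm (z m)" by blast
    qed
  qed
qed

lemma candidate_bounded: "AE s in M. s \<in> E \<longrightarrow> (\<exists>K. \<forall>m. norm (candidate (z m) s) \<le> K * norm (z m))"
  for z :: "nat \<Rightarrow> 'x"
proof (rule biorthogonal_cases[where 'a = 'x])
  show ?thesis if "biorthogonal n u \<phi>" "finite_expansion n u \<phi> = id_blinfun" for n and u :: "nat \<Rightarrow> 'x" and \<phi>
    using that by (rule candidate_bounded_finite)
  show ?thesis if "\<And>n. biorthogonal n u \<phi>" for u :: "nat \<Rightarrow> 'x" and \<phi>
    using that by (rule candidate_bounded_infinite)
qed

text \<open>
  The Lipschitz estimate needs boundedness at the differences of the dense sequence, which are again countably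
  many vectors.
\<close>

lemma candidate_extends: "AE s in M. s \<in> E \<longrightarrow> (\<exists>w. w \<in> clinear_ops \<and> (\<forall>i. blinfun_apply w (D i) = candidate (D i) s))"
proof -
  define z where "z m = (case prod_decode m of (i, j) \<Rightarrow> D i - D j)" for m
  have z: "z (prod_encode (i, j)) = D i - D j" for i j
    by (simp add: z_def)
  show ?thesis
    using candidate_bounded[of z] consistent_candidate_sequence[of z] consistent_candidate_sequence[of D] AE_space
  proof eventually_elim
    case (elim s)
    show ?case
    proof
      assume s: "s \<in> E"
      then obtain K where K: "\<And>m. norm (candidate (z m) s) \<le> K * norm (z m)" using elim by blast
      have sp: "s \<in> space M" using elim by blast
      have "norm (candidate (D i) s - candidate (D j) s) \<le> K * norm (D i - D j)" for i j
      proof -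
        have "candidate (D i - D j) s = candidate (D i) s - candidate (D j) s"
        proof (rule consistent_unique)
          show "consistent s (D i - D j) (candidate (D i - D j) s)"
            using elim s z by metis
          show "consistent s (D i - D j) (candidate (D i) s - candidate (D j) s)"
            using elim s by (intro consistent_diff) auto
        qed
        then show ?thesis using K[of "prod_encode (i, j)"] by (simp add: z)
      qed
      moreover have "\<Psi> k (D i) *\<^sub>C candidate x0 s = der (cut_rank_one x0 (\<Psi> k)) s (D i) + \<Psi> k (candidate (D i) s) *\<^sub>C x0" for i k
        using elim s by (auto simp: consistent_def)
      ultimately show "\<exists>w. w \<in> clinear_ops \<and> (\<forall>i. blinfun_apply w (D i) = candidate (D i) s)"
        by (rule extend_to_clinear[where g = "\<lambda>i. candidate (D i) s" and q = "\<lambda>k. der (cut_rank_one x0 (\<Psi> k)) s",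
              OF _ der_cut_clinear[OF sp] x0_nonzero])
    qed
  qed
qed

text \<open>
  Comparing \<open>sandwich\<close> with the consistency relation at the vector \<open>f(s) x\<close> eliminates the terms with \<open>der\<close> of the
  cut off rank one functions and leaves \<open>\<Psi> k (w f x) = \<Psi> k (der f x + f w x)\<close>. That vector is not in the dense sequence; the
  relation holds there because it is continuous in the vector once \<open>candidate\<close> is replaced by \<open>w\<close>.
\<close>

lemma inner_on: "\<exists>w\<in>wom M. \<forall>f\<in>alg. AE s in M. s \<in> E \<longrightarrow> der f s = (w s o\<^sub>L f s) - (f s o\<^sub>L w s)"
proof -
  let ?ok = "\<lambda>s w. w \<in> clinear_ops \<and> (\<forall>i. blinfun_apply w (D i) = candidate (D i) s)"
  \<comment> \<open>Setting \<open>w = 0\<close> on an exceptional measurable null set makes \<open>w\<close> measurable everywhere.\<close>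
  obtain N where N: "N \<in> sets M" "emeasure M N = 0" "{s \<in> space M. \<not> (s \<in> E \<longrightarrow> (\<exists>w. ?ok s w))} \<subseteq> N"
    using candidate_extends by (rule AE_E)
  define w where "w s = (if s \<in> E - N then SOME w. ?ok s w else 0)" for s
  have ok: "?ok s (w s)" if "s \<in> E - N" for s
  proof -
    have "\<exists>w. ?ok s w" using that N(3) sets.sets_into_space[OF E(1)] by blast
    then show ?thesis unfolding w_def using that by (simp only: if_True) (rule someI_ex)
  qed
  have EN: "E - N \<in> sets M" using E N by blast
  then have ind: "(indicator (E - N) :: 's \<Rightarrow> complex) \<in> borel_measurable M" by simp
  have "(\<lambda>s. blinfun_apply (w s) x) \<in> weakly_measurable M" for x
  proof -
    obtain r where r: "(\<lambda>k. D (r k)) \<longlonglongrightarrow> x" by (rule dense_sequence)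
    show ?thesis
    proof (rule weakly_measurable_LIMSEQ)
      show "(\<lambda>s. indicator (E - N) s *\<^sub>C candidate (D (r k)) s) \<in> weakly_measurable M" for k
        by (intro weakly_measurable_scaleC ind candidate_measurable)
      fix s
      have "indicator (E - N) s *\<^sub>C candidate (D (r k)) s = blinfun_apply (w s) (D (r k))" for k
        using ok[of s] by (cases "s \<in> E - N") (auto simp: w_def)
      then show "(\<lambda>k. indicator (E - N) s *\<^sub>C candidate (D (r k)) s) \<longlonglongrightarrow> blinfun_apply (w s) x"
        by (simp only:) (intro blinfun.tendsto tendsto_const r)
    qed
  qed
  moreover have "w s \<in> clinear_ops" for s
    using ok[of s] by (cases "s \<in> E - N") (auto simp: w_def clinear_ops_zero)
  ultimately have w: "w \<in> wom M" by (simp add: wo_measurable_iff)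
  have "AE s in M. s \<in> E \<longrightarrow> der f s = (w s o\<^sub>L f s) - (f s o\<^sub>L w s)" if f: "f \<in> alg" for f
  proof -
    have "AE s in M. \<forall>i k. s \<in> E \<longrightarrow> \<Psi> k (f s (D i)) *\<^sub>C candidate x0 s =
        der (cut_rank_one x0 (\<Psi> k)) s (f s (D i)) + \<Psi> k (der f s (D i)) *\<^sub>C x0 + \<Psi> k (f s (candidate (D i) s)) *\<^sub>C x0"
      unfolding AE_all_countable using sandwich[OF f \<Psi>_clinear] by blast
    moreover have "AE s in M. s \<notin> N"
      using N by (intro AE_not_in) auto
    ultimately show ?thesis
      using consistent_candidate_sequence[of D] AE_space
    proof eventually_elim
      case (elim s)
      show ?case
      proof
        assume s: "s \<in> E"
        with ok[of s] elim have wD: "blinfun_apply (w s) (D i) = candidate (D i) s" for i by blast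
        have cons: "\<Psi> k x *\<^sub>C candidate x0 s = der (cut_rank_one x0 (\<Psi> k)) s x + \<Psi> k (blinfun_apply (w s) x) *\<^sub>C x0" for k x
        proof (rule eq_on_dense[of "\<lambda>z. \<Psi> k z *\<^sub>C candidate x0 s"
            "\<lambda>z. der (cut_rank_one x0 (\<Psi> k)) s z + \<Psi> k (blinfun_apply (w s) z) *\<^sub>C x0"])
          show "continuous_on UNIV (\<lambda>z. \<Psi> k z *\<^sub>C candidate x0 s)"
            by (intro linear_continuous_on bounded_linear_compose[OF bounded_linear_scaleC_left] blinfun.bounded_linear_right)
          show "continuous_on UNIV (\<lambda>z. der (cut_rank_one x0 (\<Psi> k)) s z + \<Psi> k (blinfun_apply (w s) z) *\<^sub>C x0)"
            by (intro linear_continuous_on bounded_linear_add blinfun.bounded_linear_right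
              bounded_linear_compose[OF bounded_linear_scaleC_left]
              bounded_linear_compose[OF blinfun.bounded_linear_right[of "\<Psi> k"]])
          show "\<Psi> k (D i) *\<^sub>C candidate x0 s = der (cut_rank_one x0 (\<Psi> k)) s (D i) + \<Psi> k (blinfun_apply (w s) (D i)) *\<^sub>C x0" for i
            using elim s wD by (simp add: consistent_def)
        qed
        show "der f s = (w s o\<^sub>L f s) - (f s o\<^sub>L w s)"
        proof (rule blinfun_eq_on_dense, rule eq_if_\<Psi>_eq)
          fix i k
          have "der (cut_rank_one x0 (\<Psi> k)) s (f s (D i)) + \<Psi> k (blinfun_apply (w s) (f s (D i))) *\<^sub>C x0 =
            der (cut_rank_one x0 (\<Psi> k)) s (f s (D i)) + \<Psi> k (der f s (D i)) *\<^sub>C x0 + \<Psi> k (f s (blinfun_apply (w s) (D i))) *\<^sub>C x0"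
            using elim s cons[of k "f s (D i)"] by (simp add: wD)
          then have "\<Psi> k (blinfun_apply (w s) (f s (D i))) *\<^sub>C x0 =
            (\<Psi> k (der f s (D i)) + \<Psi> k (f s (blinfun_apply (w s) (D i)))) *\<^sub>C x0"
            by (simp add: scaleC_add_left add.assoc)
          then have "\<Psi> k (blinfun_apply (w s) (f s (D i))) = \<Psi> k (der f s (D i)) + \<Psi> k (f s (blinfun_apply (w s) (D i)))"
            using x0_nonzero by (simp only: complex_vector.scale_cancel_right) simp
          then show "\<Psi> k (der f s (D i)) = \<Psi> k (((w s o\<^sub>L f s) - (f s o\<^sub>L w s)) (D i))"
            by (simp add: blinfun.diff_left blinfun.diff_right)
        qed
      qed
    qed
  qed
  with w show ?thesis by blast
qed

end

section \<open>Gluing over a cover by sets of finite measure\<close>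

context admissible_derivation
begin

lemma inner:
  assumes "sigma_finite_measure M"
  shows "\<exists>w\<in>wom M. \<forall>f\<in>alg. AE s in M. der f s = (w s o\<^sub>L f s) - (f s o\<^sub>L w s)"
proof (cases "\<exists>x0 :: 'x. x0 \<noteq> 0")
  case False
  then have "S = T" for S T :: "'x \<Rightarrow>\<^sub>L 'x"
    by (intro blinfun_eqI) metis
  then show ?thesis
    using wom_const[OF clinear_ops_zero] by (intro bexI[of _ "\<lambda>_. 0"]) auto
next
  case True
  then obtain x1 :: 'x where x1: "x1 \<noteq> 0" by blast
  obtain \<phi>0 :: "'x \<Rightarrow>\<^sub>L complex" where \<phi>0: "\<phi>0 \<in> clinear_ops" "\<phi>0 x1 = of_real (norm x1)"
    using norming_functional[of x1] by blast
  define x0 where "x0 = inverse (complex_of_real (norm x1)) *\<^sub>C x1"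
  have x0: "\<phi>0 x0 = 1"
    using x1 \<phi>0 by (simp add: x0_def functional_scaleC)
  obtain E :: "nat \<Rightarrow> 's set" where E: "range E \<subseteq> sets M" "(\<Union>i. E i) = space M" "\<And>i. emeasure M (E i) \<noteq> \<infinity>"
    using sigma_finite_measure.sigma_finite[OF assms] by metis
  have "\<exists>w\<in>wom M. \<forall>f\<in>alg. AE s in M. s \<in> E n \<longrightarrow> der f s = (w s o\<^sub>L f s) - (f s o\<^sub>L w s)" for n
  proof -
    interpret admissible_derivation_on D \<Psi> M A \<delta> x0 \<phi>0 "E n"
      by unfold_locales (use \<phi>0 x0 E in \<open>auto simp: less_top\<close>)
    show ?thesis by (rule inner_on)
  qed
  then have "\<forall>n. \<exists>w. w \<in> wom M \<and> (\<forall>f\<in>alg. AE s in M. s \<in> E n \<longrightarrow> der f s = (w s o\<^sub>L f s) - (f s o\<^sub>L w s))"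
    by blast
  from choice[OF this] obtain w where "\<forall>n. w n \<in> wom M \<and>
      (\<forall>f\<in>alg. AE s in M. s \<in> E n \<longrightarrow> der f s = (w n s o\<^sub>L f s) - (f s o\<^sub>L w n s))" ..
  then have w: "\<And>n. w n \<in> wom M"
    and inner: "\<And>n f. f \<in> alg \<Longrightarrow> AE s in M. s \<in> E n \<longrightarrow> der f s = (w n s o\<^sub>L f s) - (f s o\<^sub>L w n s)"
    by blast+
  define j where "j s = (LEAST n. s \<in> E n)" for s
  have [measurable]: "E n \<in> sets M" for n using E(1) by blast
  have j: "j \<in> measurable M (count_space UNIV)"
    unfolding j_def by measurable
  have Ej: "s \<in> E (j s)" if "s \<in> space M" for s
    unfolding j_def using that E(2) by (metis LeastI UN_E)
  show ?thesis
  proof (intro bexI[of _ "\<lambda>s. w (j s) s"] ballI)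
    show "(\<lambda>s. w (j s) s) \<in> wom M"
      using w by (auto simp: wo_measurable_iff
        intro!: weakly_measurable_countable_index[OF _ j, of "\<lambda>n s. blinfun_apply (w n s) _"])
    fix f
    assume "f \<in> alg"
    then have "AE s in M. \<forall>n. s \<in> E n \<longrightarrow> der f s = (w n s o\<^sub>L f s) - (f s o\<^sub>L w n s)"
      unfolding AE_all_countable using inner by blast
    then show "AE s in M. der f s = (w (j s) s o\<^sub>L f s) - (f s o\<^sub>L w (j s) s)"
      using AE_space by eventually_elim (use Ej in blast)
  qed
qed

end

theorem theorem5p17:
  fixes M :: "'s measure"
    and U :: "('x::complex_banach \<Rightarrow>\<^sub>L 'x) set"
    and A :: "('s \<Rightarrow> 'x \<Rightarrow>\<^sub>L 'x) set set"
    and \<delta> :: "('s \<Rightarrow> 'x \<Rightarrow>\<^sub>L 'x) set \<Rightarrow> ('s \<Rightarrow> 'x \<Rightarrow>\<^sub>L 'x) set"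
  assumes "separable_space (euclidean :: 'x topology)"
    and "sigma_finite_measure M"
    and "complete_measure M"
    and "closed_standard_algebra U"
    and "admissible M U A"
    and "wo_derivation M A \<delta>"
    and "Linf_linear_on M A \<delta>"
  shows "\<exists>W \<in> L0_wo M clinear_ops. \<forall>F\<in>A. \<delta> F = wo_diff M (wo_mult M W F) (wo_mult M F W)"
proof -
  obtain D :: "nat \<Rightarrow> 'x" and \<Psi> where seq: "norming_sequences D \<Psi>"
    using exists_norming_sequences[OF assms(1)] by blast
  have sub: "wo_subalgebra M A"
    and Linf: "\<forall>g\<in>Linf M. \<forall>F\<in>A. wo_scale M g F \<in> A"
    and compact: "\<forall>F\<in>Linf_wo M clinear_ops.
      (\<forall>\<epsilon>::real. \<epsilon> > 0 \<longrightarrow> (\<exists>p\<in>finite_rank_idempotents.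
        wo_norm M (wo_mult M F (wo_const M (id_blinfun - p))) \<le> ennreal \<epsilon>)) \<longrightarrow>
      (\<forall>E\<in>sets M. emeasure M E < \<infinity> \<longrightarrow> wo_scale M (indicator E) F \<in> A)"
    using assms(5) unfolding admissible_def by blast+
  interpret admissible_derivation D \<Psi> M A \<delta>
    by (intro admissible_derivation.intro[OF seq] admissible_derivation_axioms.intro sub assms(6,7))
      (use Linf compact in blast)+
  obtain w where w: "w \<in> wom M" and inner: "\<And>f. f \<in> alg \<Longrightarrow> AE s in M. der f s = (w s o\<^sub>L f s) - (f s o\<^sub>L w s)"
    using inner[OF assms(2)] by blast
  show ?thesis
  proof (intro bexI ballI)
    show "wo_class M w \<in> L0_wo M clinear_ops" by (rule wo_class_in_L0_wo[OF w])
    fix F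
    assume F: "F \<in> A"
    then obtain f where f: "f \<in> wom M" "F = wo_class M f"
      using sub by (auto simp: wo_subalgebra_def elim: L0_woE)
    with F have alg: "f \<in> alg" by (simp add: alg_def)
    have m: "der f \<in> wom M" "(\<lambda>s. w s o\<^sub>L f s) \<in> wom M" "(\<lambda>s. f s o\<^sub>L w s) \<in> wom M"
      using der_class[OF alg] w f by (auto intro: wom_compose)
    have "\<delta> F = wo_class M (der f)"
      using der_class[OF alg] f by simp
    also have "\<dots> = wo_class M (\<lambda>s. (w s o\<^sub>L f s) - (f s o\<^sub>L w s))"
      using inner[OF alg] m by (simp add: wo_class_eq_iff wom_diff)
    also have "\<dots> = wo_diff M (wo_mult M (wo_class M w) F) (wo_mult M F (wo_class M w))"
      using w f m by (simp add: wo_mult_class wo_diff_class)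
    finally show "\<delta> F = wo_diff M (wo_mult M (wo_class M w) F) (wo_mult M F (wo_class M w))" .
  qed
qed

end
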